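(* Let $L\in\mathbb{R}^{m\times n}$ be nonzero, $A:\mathbb{R}^n\rightrightarrows\mathbb{R}^n$, $B:\mathbb{R}^m\rightrightarrows\mathbb{R}^m$ be outer semicontinuous, and let $\gamma,\tau>0$ be such that $\operatorname{dom}J_{\gamma A}=\mathbb{R}^n$ and $\operatorname{dom}J_{\tau B^{-1}}=\mathbb{R}^m$. Suppose that $\operatorname{zer}T_{\rm PD}\ne\emptyset$ and that there exist a nonempty set $\mathcal S^\star\subseteq\operatorname{zer}T_{\rm PD}$ and $(\mu_A,\mu_B,\rho_A,\rho_B)\in\mathbb{R}^4$ such that for every $(x^\star,y^\star)\in\mathcal S^\star$, $A$ is $(\mu_AL^\top L,\rho_AI_n)$-semimonotone at $(x^\star,-L^\top y^\star)\in\operatorname{gph}A$ and $B$ is $(\mu_BI_m,\rho_BLL^\top)$-semimonotone at $(Lx^\star,y^\star)\in\operatorname{gph}B$, and one of the following holds: (1) $\mu_A=\mu_B=0$ and $\rho_A=\rho_B=0$; (2) $\mu_A+\mu_B>0$ and $\rho_A=\rho_B=0$; (3) $\rho_A+\rho_B>0$ and $\mu_A=\mu_B=0$; (4) $\mu_A+\mu_B>0$, $\rho_A+\rho_B>0$ and $[\mu_A\Box\mu_B]_-[\rho_A\Box\rho_B]_-<\frac1{4\|L\|^2}$. Set $\beta_P=\rho_A\Box\rho_B$, $\beta_D=\mu_A\Box\mu_B$, $\delta=1-[\beta_P\beta_D]_-(\|L\|^2-\sigma_d^2)$, and $$\gamma_{\min}=\tfrac{-2\beta_P}{\delta+\sqrt{\delta^2-4\beta_P\beta_D\|L\|^2}},\quad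 \gamma_{\max}=\tfrac{\delta+\sqrt{\delta^2-4\beta_P\beta_D\|L\|^2}}{-2\beta_D\|L\|^2},\quad \tau_{\min}(\gamma)=\tfrac{[-\beta_D(\gamma+\beta_P)]_+}{\gamma(\delta-\beta_P\beta_D\|L\|^2)+\beta_P}.$$ Assume that the stepsizes satisfy: - if $\beta_P\ge0,\beta_D\ge0$: $\gamma\in(0,\infty)$, $\tau\in(0,\frac1{\gamma\|L\|^2}]$; - if $\beta_P\ge0,\beta_D<0$: $\gamma\in(0,\gamma_{\max})$, $\tau\in(\tau_{\min}(\gamma),\frac1{\gamma\|L\|^2}]$; - if $\beta_P<0,\beta_D\ge0$: $\gamma\in(\gamma_{\min},\infty)$, $\tau\in(\tau_{\min}(\gamma),\frac1{\gamma\|L\|^2}]$; - if $\beta_P<0,\beta_D<0$: $\gamma\in(\gamma_{\min},\gamma_{\max})$, $\tau\in(\tau_{\min}(\gamma),\frac1{\gamma\|L\|^2}]$. Assume that the relaxation parameters satisfy $\lambda_k\in(0,2(1+\bar\eta))$ and $\liminf_{k\to\infty}\lambda_k(2(1+\bar\eta)-\lambda_k)>0$, where, with $\Delta=\frac1{2\gamma}\beta_P+\frac1{2\tau}\beta_D$, $\theta(\sigma)=\sqrt{(\frac1{2\gamma}\beta_P-\frac1{2\tau}\beta_D)^2+\beta_P\beta_D\sigma^2}$, and $\eta'=\min\{\frac1\gamma\beta_P',\frac1\tau\beta_D'\}$ with $\beta_P'=\rho_A$ if $\operatorname{rank}L<n$, $\beta_P'=+\infty$ if $\operatorname{rank}L=n$,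 $\beta_D'=\mu_B$ if $\operatorname{rank}L<m$, $\beta_D'=+\infty$ if $\operatorname{rank}L=m$: - if $\gamma\tau<\frac1{\|L\|^2}$: $\bar\eta=\Delta-\theta(\|L\|)$ if $\mu_A\mu_B\rho_A\rho_B\ge0$, and $\bar\eta=\min\{\Delta-\theta(\sigma_d),\eta'\}$ otherwise; - if $\gamma\tau=\frac1{\|L\|^2}$ and $d=1$: $\bar\eta=2\Delta$ if $\max\{\mu_A\mu_B,\rho_A\rho_B\}\le0$, and $\bar\eta=\min\{2\Delta,\eta'\}$ otherwise; - if $\gamma\tau=\frac1{\|L\|^2}$ and $d>1$: $\bar\eta=2\Delta$ if $\max\{\mu_A\mu_B,\rho_A\rho_B\}\le0$; $\bar\eta=\Delta-\theta(\sigma_2)$ if $\min\{\mu_A\mu_B,\rho_A\rho_B\}>0$; $\bar\eta=\min\{\Delta-\theta(\sigma_d),\eta'\}$ otherwise. Let $(z^k)=(x^k,y^k)$, $(\bar z^k)=(\bar x^k,\bar y^k)$ be generated by CPA from $z^0\in\mathbb{R}^{n+m}$. Then either a point $\bar z^k\in\operatorname{zer}T_{\rm PD}$ is reached in a finite number of iterations, or the following hold: (i) $\bar v^k:=P(z^k-\bar z^k)\in T_{\rm PD}\bar z^k$ for all $k$, and $(\bar v^k)$ converges to zero. (ii) Every limit point (if any) of $(\bar z^k)$ belongs to $\operatorname{zer}T_{\rm PD}$. (iii) $(\Pi_{\operatorname{range}P}z^k)$ and $(\Pi_{\operatorname{range}P}\bar z^k)$ are bounded and their limit points belong to $\Pi_{\operatorname{range}P}\operatorname{zer}T_{\rm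 PD}$. (iv) If $\Pi_{\operatorname{range}P}\mathcal S^\star=\Pi_{\operatorname{range}P}\operatorname{zer}T_{\rm PD}$, then $(\Pi_{\operatorname{range}P}z^k)$ and $(\Pi_{\operatorname{range}P}\bar z^k)$ converge to some element of $\Pi_{\operatorname{range}P}\operatorname{zer}T_{\rm PD}$. If additionally $J_{\gamma A}$ and $J_{\tau B^{-1}}$ are (single-valued) continuous, then $(\bar z^k)$ converges to some $z^\star\in\operatorname{zer}T_{\rm PD}$. Finally, if additionally $\lambda_k$ is uniformly bounded in the interval $(0,2)$, then $(z^k)$ also converges to $z^\star$.
   Context: For a set-valued operator $A$: $\operatorname{gph}A=\{(x,y):y\in Ax\}$, $\operatorname{zer}A=\{x:0\in Ax\}$, $A^{-1}$ is the inverse relation, $J_A=(\mathrm{id}+A)^{-1}$. $A$ is outer semicontinuous if its graph is closed. $[t]_+=\max\{0,t\}$, $[t]_-=-\min\{0,t\}$. $\Pi_E$ is the orthogonal projection onto the subspace $E$ (applied elementwise to sets). For scalars with $\alpha=\beta=0$ or $\alpha+\beta\ne0$, the parallel sum is $\alpha\Box\beta=0$ if $\alpha=\beta=0$, and $\alpha\Box\beta=\frac{\alpha\beta}{\alpha+\beta}$ otherwise. $\sigma_1>\dots>\sigma_d>0$ are the distinct strictly positive singular values of $L$; $\|L\|=\sigma_1$. $T_{\rm PD}(x,y)=(Ax+L^\top y)\times(B^{-1}y-Lx)$ on $\mathbb{R}^{n+m}$. For symmetric (possibly indefinite) $M,R$, an operator $A$ is $(M,R)$-semimonotone at $(x',y')\in\operatorname{gph}A$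 if $\langle x-x',y-y'\rangle\ge\langle x-x',M(x-x')\rangle+\langle y-y',R(y-y')\rangle$ for all $(x,y)\in\operatorname{gph}A$. Chambolle--Pock algorithm (CPA): given $\gamma,\tau>0$, $\lambda_k>0$, $z^0=(x^0,y^0)$, iterate $\bar x^k\in J_{\gamma A}(x^k-\gamma L^\top y^k)$, $\bar y^k\in J_{\tau B^{-1}}(y^k+\tau L(2\bar x^k-x^k))$, $x^{k+1}=x^k+\lambda_k(\bar x^k-x^k)$, $y^{k+1}=y^k+\lambda_k(\bar y^k-y^k)$. $P=\begin{bmatrix}\frac1\gamma I_n&-L^\top\\-L&\frac1\tau I_m\end{bmatrix}$. "Uniformly bounded in $(0,2)$" means contained in a compact subinterval of $(0,2)$. *)

theory Defs
  imports "HOL-Analysis.Analysis"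
begin

section \<open>Set-valued operators\<close>

definition gph :: "('a \<Rightarrow> 'b set) \<Rightarrow> ('a \<times> 'b) set" where
  "gph A = {(x, y). y \<in> A x}"

definition zer :: "('a \<Rightarrow> 'b::zero set) \<Rightarrow> 'a set" where
  "zer A = {x. 0 \<in> A x}"

definition inv_op :: "('a \<Rightarrow> 'b set) \<Rightarrow> 'b \<Rightarrow> 'a set" where
  "inv_op A y = {x. y \<in> A x}"

definition dom_op :: "('a \<Rightarrow> 'b set) \<Rightarrow> 'a set" where
  "dom_op A = {x. A x \<noteq> {}}"

definition scale_op :: "real \<Rightarrow> ('a \<Rightarrow> 'b::real_vector set) \<Rightarrow> 'a \<Rightarrow> 'b set" where
  "scale_op c A x = (\<lambda>u. c *\<^sub>R u) ` A x"

definition resolvent :: "('a::plus \<Rightarrow> 'a set) \<Rightarrow> 'a \<Rightarrow> 'a set" where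
  "resolvent A = inv_op (\<lambda>x. (\<lambda>u. x + u) ` A x)"

definition outer_semicontinuous ::
    "('a::topological_space \<Rightarrow> 'b::topological_space set) \<Rightarrow> bool" where
  "outer_semicontinuous A \<longleftrightarrow> closed (gph A)"

definition single_valued_continuous ::
    "('a::topological_space \<Rightarrow> 'b::topological_space set) \<Rightarrow> bool" where
  "single_valued_continuous A \<longleftrightarrow> (\<exists>f. continuous_on UNIV f \<and> (\<forall>x. A x = {f x}))"

text \<open>The matrices \<open>M\<close> and \<open>R\<close> are meant to be symmetric, but need not be semidefinite.\<close>

definition semimonotone_at ::
    "real^'n^'n \<Rightarrow> real^'n^'n \<Rightarrow> (real^'n \<Rightarrow> (real^'n) set) \<Rightarrow> real^'n \<Rightarrow> real^'n \<Rightarrow> bool" where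
  "semimonotone_at M R A x' y' \<longleftrightarrow>
     (x', y') \<in> gph A \<and>
     (\<forall>(x, y) \<in> gph A.
        (x - x') \<bullet> (y - y') \<ge> (x - x') \<bullet> (M *v (x - x')) + (y - y') \<bullet> (R *v (y - y')))"

text \<open>Limit points of a sequence are limits of its subsequences; this differs from
  \<open>l islimpt range X\<close>, e.g. for a constant sequence.\<close>

definition seq_limit_point :: "(nat \<Rightarrow> 'a::topological_space) \<Rightarrow> 'a \<Rightarrow> bool" where
  "seq_limit_point X l \<longleftrightarrow> (\<exists>r. strict_mono r \<and> (X \<circ> r) \<longlonglongrightarrow> l)"


section \<open>Scalars and singular values\<close>

definition pos_part :: "real \<Rightarrow> real" where
  "pos_part t = max 0 t"

definition neg_part :: "real \<Rightarrow> real" where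
  "neg_part t = - min 0 t"

text \<open>Only meaningful if \<open>a = b = 0\<close> or \<open>a + b \<noteq> 0\<close>.\<close>

definition parallel_sum :: "real \<Rightarrow> real \<Rightarrow> real"  (infixl "\<box>" 70) where
  "a \<box> b = (if a = 0 \<and> b = 0 then 0 else a * b / (a + b))"

abbreviation opnorm :: "real^'n^'m \<Rightarrow> real" where
  "opnorm L \<equiv> onorm ((*v) L)"

definition pos_singular_values :: "real^'n^'m \<Rightarrow> real set" where
  "pos_singular_values L =
     {s. s > 0 \<and> (\<exists>v. v \<noteq> 0 \<and> (transpose L ** L) *v v = s\<^sup>2 *\<^sub>R v)}"

lemma finite_pos_singular_values: "finite (pos_singular_values L)"
proof -
  let ?S = "pos_singular_values L" and ?M = "transpose L ** L"
  have "\<forall>s\<in>?S. \<exists>v. v \<noteq> 0 \<and> ?M *v v = s\<^sup>2 *\<^sub>R v"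
    by (auto simp: pos_singular_values_def)
  from bchoice[OF this] obtain v where v: "\<And>s. s \<in> ?S \<Longrightarrow> v s \<noteq> 0 \<and> ?M *v v s = s\<^sup>2 *\<^sub>R v s"
    by blast
  have "transpose ?M = ?M"
    by (simp add: matrix_transpose_mul)
  then have sym: "(?M *v a) \<bullet> b = a \<bullet> (?M *v b)" for a b
    by (metis dot_lmul_matrix vector_transpose_matrix)
  have orth: "v s \<bullet> v t = 0" if "s \<in> ?S" "t \<in> ?S" "s \<noteq> t" for s t
  proof -
    have "s\<^sup>2 * (v s \<bullet> v t) = t\<^sup>2 * (v s \<bullet> v t)"
      using sym[of "v s" "v t"] v that by simp
    moreover have "s\<^sup>2 \<noteq> t\<^sup>2"
      using that by (auto simp: pos_singular_values_def power2_eq_iff)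
    ultimately show ?thesis by simp
  qed
  have "inj_on v ?S"
    using orth v by (metis inj_onI inner_eq_zero_iff)
  moreover have "finite (v ` ?S)"
    by (rule pairwise_orthogonal_imp_finite) (metis (mono_tags) pairwise_imageI orth orthogonal_def)
  ultimately show ?thesis
    using finite_imageD by blast
qed

definition num_sv :: "real^'n^'m \<Rightarrow> nat" where
  "num_sv L = card (pos_singular_values L)"

text \<open>\<open>sv L i\<close> is the \<open>i\<close>-th largest distinct strictly positive singular value,
  for \<open>1 \<le> i \<le> num_sv L\<close> (counting from one).\<close>

definition sv :: "real^'n^'m \<Rightarrow> nat \<Rightarrow> real" where
  "sv L i = rev (sorted_list_of_set (pos_singular_values L)) ! (i - 1)"


section \<open>Primal-dual operator and Chambolle--Pock algorithm\<close>

text \<open>The space \<open>R^(n+m)\<close> is rendered as the product \<open>(real^'n) \<times> (real^'m)\<close>, which carries the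
  Euclidean inner product.\<close>

definition T_PD :: "real^'n^'m \<Rightarrow> (real^'n \<Rightarrow> (real^'n) set) \<Rightarrow> (real^'m \<Rightarrow> (real^'m) set) \<Rightarrow>
    (real^'n) \<times> (real^'m) \<Rightarrow> ((real^'n) \<times> (real^'m)) set" where
  "T_PD L A B = (\<lambda>(x, y).
     ((\<lambda>u. u + transpose L *v y) ` A x) \<times> ((\<lambda>u. u - L *v x) ` inv_op B y))"

definition P_op :: "real^'n^'m \<Rightarrow> real \<Rightarrow> real \<Rightarrow> (real^'n) \<times> (real^'m) \<Rightarrow> (real^'n) \<times> (real^'m)" where
  "P_op L \<gamma> \<tau> = (\<lambda>(x, y).
     ((1 / \<gamma>) *\<^sub>R x - transpose L *v y, - (L *v x) + (1 / \<tau>) *\<^sub>R y))"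

text \<open>The orthogonal projection onto the subspace \<open>range P\<close> is its nearest-point map.\<close>

definition proj_P :: "real^'n^'m \<Rightarrow> real \<Rightarrow> real \<Rightarrow> (real^'n) \<times> (real^'m) \<Rightarrow> (real^'n) \<times> (real^'m)" where
  "proj_P L \<gamma> \<tau> = closest_point (range (P_op L \<gamma> \<tau>))"

definition CPA :: "real^'n^'m \<Rightarrow> (real^'n \<Rightarrow> (real^'n) set) \<Rightarrow> (real^'m \<Rightarrow> (real^'m) set) \<Rightarrow>
    real \<Rightarrow> real \<Rightarrow> (nat \<Rightarrow> real) \<Rightarrow>
    (nat \<Rightarrow> real^'n) \<Rightarrow> (nat \<Rightarrow> real^'m) \<Rightarrow> (nat \<Rightarrow> real^'n) \<Rightarrow> (nat \<Rightarrow> real^'m) \<Rightarrow> bool" where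
  "CPA L A B \<gamma> \<tau> lam x y xbar ybar \<longleftrightarrow>
     (\<forall>k. xbar k \<in> resolvent (scale_op \<gamma> A) (x k - \<gamma> *\<^sub>R (transpose L *v y k)) \<and>
          ybar k \<in> resolvent (scale_op \<tau> (inv_op B))
                     (y k + \<tau> *\<^sub>R (L *v (2 *\<^sub>R xbar k - x k))) \<and>
          x (Suc k) = x k + lam k *\<^sub>R (xbar k - x k) \<and>
          y (Suc k) = y k + lam k *\<^sub>R (ybar k - y k))"


section \<open>Stepsize and relaxation rules\<close>

definition delta :: "real^'n^'m \<Rightarrow> real \<Rightarrow> real \<Rightarrow> real" where
  "delta L \<beta>P \<beta>D = 1 - neg_part (\<beta>P * \<beta>D) * ((opnorm L)\<^sup>2 - (sv L (num_sv L))\<^sup>2)"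

definition gamma_min :: "real^'n^'m \<Rightarrow> real \<Rightarrow> real \<Rightarrow> real" where
  "gamma_min L \<beta>P \<beta>D = (let \<delta> = delta L \<beta>P \<beta>D in
     - 2 * \<beta>P / (\<delta> + sqrt (\<delta>\<^sup>2 - 4 * \<beta>P * \<beta>D * (opnorm L)\<^sup>2)))"

definition gamma_max :: "real^'n^'m \<Rightarrow> real \<Rightarrow> real \<Rightarrow> real" where
  "gamma_max L \<beta>P \<beta>D = (let \<delta> = delta L \<beta>P \<beta>D in
     (\<delta> + sqrt (\<delta>\<^sup>2 - 4 * \<beta>P * \<beta>D * (opnorm L)\<^sup>2)) / (- 2 * \<beta>D * (opnorm L)\<^sup>2))"

definition tau_min :: "real^'n^'m \<Rightarrow> real \<Rightarrow> real \<Rightarrow> real \<Rightarrow> real" where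
  "tau_min L \<beta>P \<beta>D \<gamma> = (let \<delta> = delta L \<beta>P \<beta>D in
     pos_part (- \<beta>D * (\<gamma> + \<beta>P)) / (\<gamma> * (\<delta> - \<beta>P * \<beta>D * (opnorm L)\<^sup>2) + \<beta>P))"

definition stepsize_rule :: "real^'n^'m \<Rightarrow> real \<Rightarrow> real \<Rightarrow> real \<Rightarrow> real \<Rightarrow> bool" where
  "stepsize_rule L \<beta>P \<beta>D \<gamma> \<tau> \<longleftrightarrow>
     (\<beta>P \<ge> 0 \<and> \<beta>D \<ge> 0 \<longrightarrow>
        \<gamma> \<in> {0<..} \<and> \<tau> \<in> {0<..1 / (\<gamma> * (opnorm L)\<^sup>2)}) \<and>
     (\<beta>P \<ge> 0 \<and> \<beta>D < 0 \<longrightarrow>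
        \<gamma> \<in> {0<..<gamma_max L \<beta>P \<beta>D} \<and>
        \<tau> \<in> {tau_min L \<beta>P \<beta>D \<gamma><..1 / (\<gamma> * (opnorm L)\<^sup>2)}) \<and>
     (\<beta>P < 0 \<and> \<beta>D \<ge> 0 \<longrightarrow>
        \<gamma> \<in> {gamma_min L \<beta>P \<beta>D<..} \<and>
        \<tau> \<in> {tau_min L \<beta>P \<beta>D \<gamma><..1 / (\<gamma> * (opnorm L)\<^sup>2)}) \<and>
     (\<beta>P < 0 \<and> \<beta>D < 0 \<longrightarrow>
        \<gamma> \<in> {gamma_min L \<beta>P \<beta>D<..<gamma_max L \<beta>P \<beta>D} \<and>
        \<tau> \<in> {tau_min L \<beta>P \<beta>D \<gamma><..1 / (\<gamma> * (opnorm L)\<^sup>2)})"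

definition Delta :: "real \<Rightarrow> real \<Rightarrow> real \<Rightarrow> real \<Rightarrow> real" where
  "Delta \<beta>P \<beta>D \<gamma> \<tau> = 1 / (2 * \<gamma>) * \<beta>P + 1 / (2 * \<tau>) * \<beta>D"

definition theta :: "real \<Rightarrow> real \<Rightarrow> real \<Rightarrow> real \<Rightarrow> real \<Rightarrow> real" where
  "theta \<beta>P \<beta>D \<gamma> \<tau> \<sigma> =
     sqrt ((1 / (2 * \<gamma>) * \<beta>P - 1 / (2 * \<tau>) * \<beta>D)\<^sup>2 + \<beta>P * \<beta>D * \<sigma>\<^sup>2)"

definition eta' :: "real^'n^'m \<Rightarrow> real \<Rightarrow> real \<Rightarrow> real \<Rightarrow> real \<Rightarrow> ereal" where
  "eta' L \<rho>A \<mu>B \<gamma> \<tau> =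
     (let \<beta>P' = (if rank L < CARD('n) then ereal \<rho>A else \<infinity>);
          \<beta>D' = (if rank L < CARD('m) then ereal \<mu>B else \<infinity>)
      in min (ereal (1 / \<gamma>) * \<beta>P') (ereal (1 / \<tau>) * \<beta>D'))"

text \<open>The value \<open>\<infinity>\<close> of \<open>eta'\<close> is absorbed by the minimum with a real number, so that
  \<open>real_of_ereal\<close> is only applied to finite values. The two outer \<open>else\<close> branches (\<open>d = 1\<close>, \<open>d > 1\<close>) are reached only if
  \<open>\<gamma> * \<tau> = 1 / (opnorm L)\<^sup>2\<close>, given the stepsize rule.\<close>

definition eta_bar ::
    "real^'n^'m \<Rightarrow> real \<Rightarrow> real \<Rightarrow> real \<Rightarrow> real \<Rightarrow> real \<Rightarrow> real \<Rightarrow> real" where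
  "eta_bar L \<mu>A \<mu>B \<rho>A \<rho>B \<gamma> \<tau> =
     (let \<beta>P = \<rho>A \<box> \<rho>B; \<beta>D = \<mu>A \<box> \<mu>B; d = num_sv L;
          \<Delta> = Delta \<beta>P \<beta>D \<gamma> \<tau>; \<theta> = theta \<beta>P \<beta>D \<gamma> \<tau>;
          min_eta' = (\<lambda>t. real_of_ereal (min (ereal t) (eta' L \<rho>A \<mu>B \<gamma> \<tau>)))
      in if \<gamma> * \<tau> < 1 / (opnorm L)\<^sup>2 then
           (if \<mu>A * \<mu>B * \<rho>A * \<rho>B \<ge> 0 then \<Delta> - \<theta> (opnorm L)
            else min_eta' (\<Delta> - \<theta> (sv L d)))
         else if d = 1 then
           (if max (\<mu>A * \<mu>B) (\<rho>A * \<rho>B) \<le> 0 then 2 * \<Delta>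
            else min_eta' (2 * \<Delta>))
         else
           (if max (\<mu>A * \<mu>B) (\<rho>A * \<rho>B) \<le> 0 then 2 * \<Delta>
            else if min (\<mu>A * \<mu>B) (\<rho>A * \<rho>B) > 0 then \<Delta> - \<theta> (sv L 2)
            else min_eta' (\<Delta> - \<theta> (sv L d))))"

end

(*
  Adding the two semimonotonicity inequalities at a point z* of S and minimising over the unknown
  vectors L dx and L^T dy leaves a quadratic form in v = P w, w = z^k - zbar^k, in which the
  moduli combine to their parallel sums. In a singular basis of L this form splits into 2 x 2 blocks,
  whose eigenvalues are Delta +- theta(sigma); hence the pointwise estimate
  <zbar^k - z*, P w> >= eta <w, P w>. The block decomposition is obtained by induction on
  subspaces invariant under L^T L, each step splitting off an eigenvector.

  With this estimate the relaxed iteration is Fejer monotone in the (possibly degenerate) seminorm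
  of P, so P w tends to zero. The sequence zbar is bounded, although P only controls the projection
  onto range P: if all moduli vanish the resolvents are locally bounded by monotonicity at one point,
  and otherwise a positive sum of moduli bounds L dx or L^T dy. Opial's argument does the rest.
*)

theory Submission
  imports Defs
begin

text \<open>Two degeneracies explain the case list of \<open>eta_bar\<close>. First, the components
  of \<open>w\<close> in the kernels of \<open>L\<close> and of \<open>transpose L\<close> belong to
  no singular block. They are orthogonal to \<open>L^T dy\<close> and to \<open>L dx\<close>
  respectively, so they never mix with the vectors minimised over and are weighed by
  \<open>\<rho>A\<close> and \<open>\<mu>B\<close> alone; this is the origin of \<open>eta'\<close>.
  Second, if the product of the stepsizes equals \<open>1 / (opnorm L)\<^sup>2\<close>, the block of
  P at the largest singular value has rank one. There only the trace \<open>2 * \<Delta>\<close>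
  survives as a bound, while the singular values from \<open>sv L 2\<close> downwards still
  contribute \<open>\<Delta> - \<theta>\<close>. The product of the two parallel sums may have
  either sign, and \<open>\<theta>\<close> grows or falls with the singular value accordingly. That
  sign decides whether the largest or the smallest singular value is the worst one. Single moduli
  may be negative and only their sums are signed, so every lower bound goes through a completed
  square whose weight is the sum.\<close>

section \<open>Singular values\<close>

text \<open>The rule rewrites \<open>transpose L *v y\<close> to \<open>y v* L\<close>; without it
  the adjoint keeps the shape in which the definitions and the lemmas below mention it.\<close>

declare transpose_matrix_vector [simp del]

lemma matrix_transpose_inner: "(L *v a) \<bullet> b = a \<bullet> (transpose L *v b)" for L :: "real^'n^'m"
  by (metis dot_lmul_matrix inner_commute transpose_matrix_vector)

text \<open>First-order optimality: the quadratic vanishes at \<open>t = 0\<close>, so it can stay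
  nonnegative only if its slope there is zero.\<close>

lemma inner_eq_zero_if_perturbation_nonneg:
  fixes b c :: real
  assumes "\<And>t. 0 \<le> 2 * t * b + t\<^sup>2 * c"
  shows "b = 0"
proof (rule ccontr)
  assume "b \<noteq> 0"
  \<comment> \<open>Adding one makes \<open>K\<close> positive even when \<open>c = 0\<close>, so
    that \<open>- b / K\<close>, the minimiser of \<open>2 * t * b + t\<^sup>2 * K\<close>, can
    serve as test value.\<close>
  define K where "K = \<bar>c\<bar> + 1"
  have K: "K > 0" "c \<le> K" by (auto simp: K_def)
  have "0 \<le> 2 * (- b / K) * b + (- b / K)\<^sup>2 * c" by (rule assms)
  also have "\<dots> \<le> 2 * (- b / K) * b + (- b / K)\<^sup>2 * K"
    using K by (intro add_left_mono mult_left_mono) auto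
  also have "\<dots> = - (b\<^sup>2 / K)" using K by (simp add: field_simps power2_eq_square)
  also have "\<dots> < 0" using K \<open>b \<noteq> 0\<close> by simp
  finally show False by simp
qed

text \<open>The variational step of the spectral theorem: a maximiser of the quadratic form on the
  unit sphere of an invariant subspace is an eigenvector. The last clause records maximality, which
  identifies the operator norm below.\<close>

lemma rayleigh_maximizer:
  fixes f :: "'a::euclidean_space \<Rightarrow> 'a"
  assumes f: "linear f" and sym: "\<And>x y. f x \<bullet> y = x \<bullet> f y"
    and V: "subspace V" "\<And>x. x \<in> V \<Longrightarrow> f x \<in> V" "x0 \<in> V" "x0 \<noteq> 0"
  obtains v where "v \<in> V" "norm v = 1" "f v = (v \<bullet> f v) *\<^sub>R v"
    "\<And>x. x \<in> V \<Longrightarrow> x \<bullet> f x \<le> (v \<bullet> f v) * (x \<bullet> x)"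
proof -
  have "(1 / norm x0) *\<^sub>R x0 \<in> V \<inter> sphere 0 1"
    using V by (simp add: subspace_scale)
  then have ne: "V \<inter> sphere 0 1 \<noteq> {}" by blast
  have "compact (V \<inter> sphere 0 1)"
    using V by (simp add: closed_Int_compact closed_subspace)
  moreover have "continuous_on (V \<inter> sphere 0 1) (\<lambda>x. x \<bullet> f x)"
    using f by (intro continuous_intros linear_continuous_on) (simp add: linear_conv_bounded_linear)
  ultimately obtain v where v: "v \<in> V" "norm v = 1"
    and max: "\<And>x. x \<in> V \<Longrightarrow> norm x = 1 \<Longrightarrow> x \<bullet> f x \<le> v \<bullet> f v"
    using continuous_attains_sup[OF _ ne, of "\<lambda>x. x \<bullet> f x"] by auto
  define l where "l = v \<bullet> f v"
  have bound: "x \<bullet> f x \<le> l * (x \<bullet> x)" if "x \<in> V" for x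
  proof (cases "x = 0")
    case False
    let ?y = "(1 / norm x) *\<^sub>R x"
    have "?y \<bullet> f ?y \<le> l"
      using max[of ?y] that False V by (simp add: subspace_scale l_def)
    moreover have "?y \<bullet> f ?y = (x \<bullet> f x) / (x \<bullet> x)"
      using f by (simp add: linear_cmul dot_square_norm power2_eq_square)
    ultimately have "(x \<bullet> f x) / (x \<bullet> x) \<le> l" by (simp only:)
    then show ?thesis using False by (simp add: divide_le_eq)
  qed simp
  \<comment> \<open>Stationarity along directions of \<open>V\<close> only. Since \<open>f\<close>
    maps \<open>V\<close> into itself, the residual \<open>l *\<^sub>R v - f v\<close> is such a
    direction, and testing with it shows that it is zero.\<close>
  have stat: "l * (v \<bullet> u) - f v \<bullet> u = 0" if u: "u \<in> V" for u
  proof (rule inner_eq_zero_if_perturbation_nonneg)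
    fix t :: real
    have "v + t *\<^sub>R u \<in> V" using u v V by (simp add: subspace_add subspace_scale)
    from bound[OF this]
    have "0 \<le> l * ((v + t *\<^sub>R u) \<bullet> (v + t *\<^sub>R u)) - (v + t *\<^sub>R u) \<bullet> f (v + t *\<^sub>R u)" by simp
    also have "\<dots> = l * (v \<bullet> v) - v \<bullet> f v + 2 * t * (l * (v \<bullet> u) - f v \<bullet> u) + t\<^sup>2 * (l * (u \<bullet> u) - u \<bullet> f u)"
      using f sym[of v u]
      by (simp add: linear_add linear_cmul inner_add inner_commute algebra_simps power2_eq_square)
    finally show "0 \<le> 2 * t * (l * (v \<bullet> u) - f v \<bullet> u) + t\<^sup>2 * (l * (u \<bullet> u) - u \<bullet> f u)"
      using v by (simp add: l_def dot_square_norm)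
  qed
  have "l *\<^sub>R v - f v \<in> V" using v V by (simp add: subspace_diff subspace_scale)
  from stat[OF this] have "(l *\<^sub>R v - f v) \<bullet> (l *\<^sub>R v - f v) = 0"
    by (simp add: inner_diff_left)
  then have "f v = l *\<^sub>R v" by simp
  with v bound show thesis by (intro that[of v, folded l_def])
qed

lemma opnorm_bound: "norm (L *v x) \<le> opnorm L * norm x" for L :: "real^'n^'m"
  by (rule onorm) simp

lemma opnorm_pos: "L \<noteq> 0 \<Longrightarrow> 0 < opnorm L" for L :: "real^'n^'m"
  by (subst onorm_pos_lt) (simp_all add: matrix_eq)

lemma pos_singular_value_le_opnorm:
  fixes L :: "real^'n^'m"
  assumes "s \<in> pos_singular_values L"
  shows "s \<le> opnorm L"
proof -
  from assms obtain v where s: "s > 0" and v: "v \<noteq> 0" "transpose L *v (L *v v) = s\<^sup>2 *\<^sub>R v"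
    by (auto simp: pos_singular_values_def matrix_vector_mul_assoc)
  have "(norm (L *v v))\<^sup>2 = (s * norm v)\<^sup>2"
    using v matrix_transpose_inner[of L v "L *v v"] by (simp add: dot_square_norm[symmetric] power_mult_distrib)
  then have "norm (L *v v) = s * norm v" using s by (simp add: power2_eq_iff_nonneg)
  then show ?thesis using opnorm_bound[of L v] v by simp
qed

text \<open>A maximiser \<open>v\<close> of the form of \<open>L^T L\<close> on the whole space is
  an eigenvector for \<open>s\<^sup>2\<close> with \<open>s = norm (L *v v)\<close>, and maximality
  makes \<open>s\<close> an upper bound for the operator norm.\<close>

lemma opnorm_in_pos_singular_values:
  fixes L :: "real^'n^'m"
  assumes "L \<noteq> 0"
  shows "opnorm L \<in> pos_singular_values L"
proof -
  let ?f = "\<lambda>x. transpose L *v (L *v x)"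
  have sym: "?f x \<bullet> y = x \<bullet> ?f y" for x y
    by (metis inner_commute matrix_transpose_inner)
  have lin: "linear ?f" by (simp add: matrix_vector_mul_assoc)
  obtain v where v: "norm v = 1" "?f v = (v \<bullet> ?f v) *\<^sub>R v"
    "\<And>x. x \<bullet> ?f x \<le> (v \<bullet> ?f v) * (x \<bullet> x)"
    by (rule rayleigh_maximizer[OF lin sym, of UNIV 1]) auto
  define s where "s = norm (L *v v)"
  have s2: "v \<bullet> ?f v = s\<^sup>2"
    by (simp add: s_def dot_square_norm[symmetric] matrix_transpose_inner)
  have "norm (L *v x) \<le> s * norm x" for x
  proof -
    have "(norm (L *v x))\<^sup>2 \<le> (s * norm x)\<^sup>2"
      using v(3)[of x] unfolding s2
      by (simp add: dot_square_norm[symmetric] matrix_transpose_inner power_mult_distrib)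
    then show ?thesis by (rule power2_le_imp_le) (simp add: s_def)
  qed
  then have "opnorm L \<le> s" by (rule onorm_le)
  moreover have "s \<le> opnorm L" using opnorm_bound[of L v] v(1) by (simp add: s_def)
  ultimately have "opnorm L = s" by simp
  moreover have "v \<noteq> 0" using v(1) by auto
  ultimately show ?thesis
    using v(2) opnorm_pos[OF assms] unfolding s2 pos_singular_values_def
    by (auto simp: matrix_vector_mul_assoc[symmetric] intro!: exI[of _ v])
qed

lemma sv_num_sv_le:
  assumes "s \<in> pos_singular_values L"
  shows "sv L (num_sv L) \<le> s" "num_sv L \<ge> 1"
proof -
  let ?l = "rev (sorted_list_of_set (pos_singular_values L))"
  have len: "length ?l = num_sv L" and set: "set ?l = pos_singular_values L"
    using finite_pos_singular_values[of L] by (auto simp: num_sv_def)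
  then obtain j where "j < num_sv L" "?l ! j = s" using assms by (metis in_set_conv_nth)
  then show "sv L (num_sv L) \<le> s" "num_sv L \<ge> 1"
    using sorted_rev_nth_mono[of ?l j "num_sv L - 1"] len unfolding sv_def by auto
qed

lemma sv_num_sv_pos:
  assumes "num_sv L \<ge> 1"
  shows "sv L (num_sv L) \<in> pos_singular_values L"
proof -
  let ?l = "rev (sorted_list_of_set (pos_singular_values L))"
  have len: "length ?l = num_sv L" and set: "set ?l = pos_singular_values L"
    using finite_pos_singular_values[of L] by (auto simp: num_sv_def)
  show ?thesis using assms len set nth_mem[of "num_sv L - 1" ?l] unfolding sv_def by simp
qed

text \<open>For the boundary case of the stepsizes, where the largest singular value is treated
  apart from the others.\<close>

lemma pos_singular_value_le_sv_2:
  fixes L :: "real^'n^'m"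
  assumes "s \<in> pos_singular_values L" "s < opnorm L"
  shows "s \<le> sv L 2"
proof -
  let ?l = "rev (sorted_list_of_set (pos_singular_values L))"
  have len: "length ?l = num_sv L" and set: "set ?l = pos_singular_values L"
    using finite_pos_singular_values[of L] by (auto simp: num_sv_def)
  have srt: "sorted (rev ?l)" by simp
  have "L \<noteq> 0"
  proof
    assume "L = 0"
    then show False using assms by (auto simp: pos_singular_values_def onorm_zero)
  qed
  then obtain i where i: "i < num_sv L" "?l ! i = opnorm L"
    using opnorm_in_pos_singular_values set len by (metis in_set_conv_nth)
  obtain j where j: "j < num_sv L" "?l ! j = s" using assms set len by (metis in_set_conv_nth)
  \<comment> \<open>Index zero of the decreasing list cannot carry \<open>s\<close>, because the
    entry there is at least \<open>opnorm L\<close>; \<open>sv L 2\<close> is the entry at index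
    one.\<close>
  have "j \<ge> 1"
  proof (rule ccontr)
    assume "\<not> j \<ge> 1"
    then have "?l ! i \<le> ?l ! j" using sorted_rev_nth_mono[OF srt, of j i] i len by simp
    then show False using i j assms by simp
  qed
  then show ?thesis using sorted_rev_nth_mono[OF srt, of 1 j] j len by (simp add: sv_def)
qed

text \<open>\<open>p\<close> and \<open>q\<close> stand for \<open>1 / \<gamma>\<close> and
  \<open>1 / \<tau>\<close>; \<open>scalar\<close> is the inequality on a single singular pair.
  Writing the dual vector as \<open>L *v c\<close> with \<open>c\<close> in \<open>V\<close> lets
  one subspace carry the induction for both sides, since left singular vectors come along as images.
  Injectivity of \<open>L\<close> on \<open>V\<close> keeps every singular value that is met
  strictly positive.\<close>

lemma singular_value_form_le:
  fixes L :: "real^'n^'m" and p q bP bD \<eta> :: real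
  assumes scalar: "\<And>s \<alpha> \<beta>. s \<in> pos_singular_values L \<Longrightarrow>
      \<eta> * (p * \<alpha>\<^sup>2 - 2 * s * \<alpha> * \<beta> + q * \<beta>\<^sup>2) \<le> bP * (p * \<alpha> - s * \<beta>)\<^sup>2 + bD * (q * \<beta> - s * \<alpha>)\<^sup>2"
    and "subspace V" "\<And>x. x \<in> V \<Longrightarrow> transpose L *v (L *v x) \<in> V"
    and "\<And>x. x \<in> V \<Longrightarrow> L *v x = 0 \<Longrightarrow> x = 0"
    and "a \<in> V" "c \<in> V"
  defines "b \<equiv> L *v c"
  shows "\<eta> * (p * (norm a)\<^sup>2 - 2 * ((L *v a) \<bullet> b) + q * (norm b)\<^sup>2)
    \<le> bP * (norm (p *\<^sub>R a - transpose L *v b))\<^sup>2 + bD * (norm (q *\<^sub>R b - L *v a))\<^sup>2"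
  using assms(2-6) unfolding b_def
proof (induction "dim V" arbitrary: V a c rule: less_induct)
  case less
  let ?f = "\<lambda>x. transpose L *v (L *v x)"
  have sym: "?f x \<bullet> y = x \<bullet> ?f y" for x y
    by (metis inner_commute matrix_transpose_inner)
  have lin: "linear ?f" by (simp add: matrix_vector_mul_assoc)
  show ?case
  proof (cases "\<exists>x0\<in>V. x0 \<noteq> 0")
    case False
    then have "a = 0" "c = 0" using less.prems by auto
    then show ?thesis by simp
  next
    case True
    then obtain v where v: "v \<in> V" "norm v = 1" "?f v = (v \<bullet> ?f v) *\<^sub>R v"
      using rayleigh_maximizer[OF lin sym less.prems(1,2)] by metis
    define s where "s = norm (L *v v)"
    have fv: "?f v = s\<^sup>2 *\<^sub>R v"
      using v(3) by (simp add: s_def dot_square_norm[symmetric] matrix_transpose_inner)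
    have "v \<noteq> 0" using v by auto
    then have s: "s > 0" using less.prems(3)[of v] v by (auto simp: s_def)
    then have sL: "s \<in> pos_singular_values L"
      using fv \<open>v \<noteq> 0\<close> by (auto simp: pos_singular_values_def matrix_vector_mul_assoc)
    \<comment> \<open>The complement of an eigenvector within \<open>V\<close> is again invariant,
      by self-adjointness, and has smaller dimension.\<close>
    define V' where "V' = {x \<in> V. x \<bullet> v = 0}"
    define a' where "a' = a - (a \<bullet> v) *\<^sub>R v"
    define c' where "c' = c - (c \<bullet> v) *\<^sub>R v"
    have vv: "v \<bullet> v = 1" using v by (simp add: dot_square_norm)
    have V': "subspace V'" using less.prems(1) unfolding V'_def subspace_def
      by (auto simp: inner_add_left)
    have inv: "?f x \<in> V'" if "x \<in> V'" for x
      using that less.prems(2) sym[of x v] fv by (simp add: V'_def)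
    have mem: "a' \<in> V'" "c' \<in> V'"
      using less.prems v vv unfolding V'_def a'_def c'_def
      by (auto simp: inner_diff_left intro!: subspace_diff subspace_scale)
    have "v \<notin> V'" using vv by (simp add: V'_def)
    moreover have "V' \<subseteq> V" unfolding V'_def by blast
    ultimately have "V' \<subset> V" using v(1) by blast
    then have "span V' \<subset> span V"
      by (simp only: span_eq_iff[THEN iffD2, OF V'] span_eq_iff[THEN iffD2, OF less.prems(1)])
    then have dim: "dim V' < dim V" by (rule dim_psubset)
    define b' where "b' = L *v c'"
    have IH: "\<eta> * (p * (norm a')\<^sup>2 - 2 * ((L *v a') \<bullet> b') + q * (norm b')\<^sup>2)
        \<le> bP * (norm (p *\<^sub>R a' - transpose L *v b'))\<^sup>2 + bD * (norm (q *\<^sub>R b' - L *v a'))\<^sup>2"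
      unfolding b'_def
      by (rule less.hyps[OF dim V' inv _ mem]) (use less.prems(3) in \<open>auto simp: V'_def\<close>)
    define u where "u = (1 / s) *\<^sub>R (L *v v)"
    define \<alpha> where "\<alpha> = a \<bullet> v"
    \<comment> \<open>The coordinate of \<open>L *v c\<close> along the left singular vector
      \<open>u\<close>; the factor \<open>s\<close> comes from
      \<open>L *v v = s *\<^sub>R u\<close>.\<close>
    define \<beta> where "\<beta> = s * (c \<bullet> v)"
    have Lv: "L *v v = s *\<^sub>R u" using s by (simp add: u_def)
    have Ltu: "transpose L *v u = s *\<^sub>R v"
      using fv s by (simp add: u_def matrix_vector_mult_scaleR power2_eq_square)
    have uu: "u \<bullet> u = 1" using s by (simp add: u_def dot_square_norm s_def power2_eq_square)
    have a: "a = \<alpha> *\<^sub>R v + a'" by (simp add: a'_def \<alpha>_def)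
    have c: "c = (\<beta> / s) *\<^sub>R v + c'" using s by (simp add: c'_def \<beta>_def)
    have b: "L *v c = \<beta> *\<^sub>R u + b'"
      using s by (subst c) (simp add: b'_def matrix_vector_right_distrib matrix_vector_mult_scaleR Lv)
    have La: "L *v a = (s * \<alpha>) *\<^sub>R u + L *v a'"
      by (subst a) (simp add: matrix_vector_right_distrib matrix_vector_mult_scaleR Lv mult.commute)
    have Ltb: "transpose L *v (L *v c) = (s * \<beta>) *\<^sub>R v + transpose L *v b'"
      by (subst b) (simp add: matrix_vector_right_distrib matrix_vector_mult_scaleR Ltu mult.commute)
    have o1: "v \<bullet> a' = 0" using mem by (simp add: V'_def inner_commute)
    have o2: "v \<bullet> (transpose L *v b') = 0"
      using inv[OF mem(2)] by (simp add: V'_def inner_commute b'_def)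
    have oL: "u \<bullet> (L *v x) = 0" if "x \<in> V'" for x
      using that Ltu matrix_transpose_inner[of L x u] by (simp add: V'_def inner_commute)
    have o3: "u \<bullet> b' = 0" "u \<bullet> (L *v a') = 0" using oL mem by (simp_all add: b'_def)
    have pyth: "(norm (k *\<^sub>R e + w))\<^sup>2 = k\<^sup>2 + (norm w)\<^sup>2"
      if "e \<bullet> e = 1" "e \<bullet> w = 0" for k :: real and e w :: "'z::real_inner"
      using that unfolding dot_square_norm[symmetric]
      by (simp add: inner_add inner_commute power2_eq_square)
    have n1: "(norm a)\<^sup>2 = \<alpha>\<^sup>2 + (norm a')\<^sup>2" by (subst a) (rule pyth[OF vv o1])
    have n2: "(norm (L *v c))\<^sup>2 = \<beta>\<^sup>2 + (norm b')\<^sup>2" by (subst b) (rule pyth[OF uu o3(1)])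
    have n3: "(L *v a) \<bullet> (L *v c) = s * \<alpha> * \<beta> + (L *v a') \<bullet> b'"
      unfolding La b using uu o3 by (simp add: inner_add inner_commute)
    have "p *\<^sub>R a - transpose L *v (L *v c) = (p * \<alpha> - s * \<beta>) *\<^sub>R v + (p *\<^sub>R a' - transpose L *v b')"
      unfolding Ltb by (subst a) (simp add: algebra_simps)
    then have n4: "(norm (p *\<^sub>R a - transpose L *v (L *v c)))\<^sup>2
        = (p * \<alpha> - s * \<beta>)\<^sup>2 + (norm (p *\<^sub>R a' - transpose L *v b'))\<^sup>2"
      using pyth[OF vv, of "p *\<^sub>R a' - transpose L *v b'"] o1 o2 by (simp add: inner_diff_right)
    have "q *\<^sub>R (L *v c) - L *v a = (q * \<beta> - s * \<alpha>) *\<^sub>R u + (q *\<^sub>R b' - L *v a')"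
      unfolding La b by (simp add: algebra_simps)
    then have n5: "(norm (q *\<^sub>R (L *v c) - L *v a))\<^sup>2
        = (q * \<beta> - s * \<alpha>)\<^sup>2 + (norm (q *\<^sub>R b' - L *v a'))\<^sup>2"
      using pyth[OF uu, of "q *\<^sub>R b' - L *v a'"] o3 by (simp add: inner_diff_right)
    show ?thesis
      using IH scalar[OF sL, of \<alpha> \<beta>] unfolding n1 n2 n3 n4 n5 by (simp add: algebra_simps)
  qed
qed

section \<open>The relaxation bound\<close>

text \<open>For \<open>a + b > 0\<close> the gap \<open>a - a \<box> b\<close> equals
  \<open>a\<^sup>2 / (a + b)\<close>, which is nonnegative even if one of the moduli is negative;
  likewise for \<open>b\<close>.\<close>

lemma parallel_sum_le:
  assumes "a + b > 0 \<or> a = 0 \<and> b = 0"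
  shows "a \<box> b \<le> a" "a \<box> b \<le> b"
proof -
  have "a * b / (a + b) \<le> a" "a * b / (a + b) \<le> b" if "a + b > 0"
    using that by (simp_all add: pos_divide_le_eq distrib_left)
  then show "a \<box> b \<le> a" "a \<box> b \<le> b" using assms by (auto simp: parallel_sum_def)
qed

text \<open>The relaxation rule distinguishes cases by products of moduli, the estimates by signs of
  parallel sums. Division by the positive number \<open>a + b\<close> makes the two agree.\<close>

lemma sgn_parallel_sum:
  assumes "a + b > 0 \<or> a = 0 \<and> b = 0"
  shows "sgn (a \<box> b) = sgn (a * b)"
  using assms by (auto simp: parallel_sum_def sgn_divide)

text \<open>Completion of the square in \<open>p\<close>; the second term on the left is the minimum
  over \<open>p\<close>. The exact identity is kept because its square term later yields
  coercivity.\<close>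

lemma parallel_sum_norm_bound:
  fixes p v :: "'a::real_inner"
  assumes "a + b > 0 \<or> a = 0 \<and> b = 0"
  shows "(a + b) * (norm (p + (b / (a + b)) *\<^sub>R v))\<^sup>2 + (a \<box> b) * (norm v)\<^sup>2
    = a * (norm p)\<^sup>2 + b * (norm (v + p))\<^sup>2"
proof (cases "a = 0 \<and> b = 0")
  case False
  then have ab: "a + b \<noteq> 0" using assms by auto
  define t where "t = b / (a + b)"
  have t: "t * (a + b) = b" using ab by (simp add: t_def)
  have "(norm (p + t *\<^sub>R v))\<^sup>2 = (norm p)\<^sup>2 + 2 * t * (p \<bullet> v) + t\<^sup>2 * (norm v)\<^sup>2"
    unfolding power2_norm_eq_inner by (simp add: inner_add inner_commute power2_eq_square)
  moreover have "(norm (v + p))\<^sup>2 = (norm v)\<^sup>2 + 2 * (p \<bullet> v) + (norm p)\<^sup>2"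
    unfolding power2_norm_eq_inner by (simp add: inner_add inner_commute)
  moreover have "a \<box> b = a * t" using False by (simp add: parallel_sum_def t_def)
  moreover have "(a + b) * (N + 2 * t * i + t\<^sup>2 * M) + a * t * M = a * N + b * (M + 2 * i + N)"
    for N i M :: real
  proof -
    have "(a + b) * (N + 2 * t * i + t\<^sup>2 * M) + a * t * M
        = (a + b) * N + 2 * (t * (a + b)) * i + (t * (a + b)) * (t * M) + a * t * M"
      by algebra
    also have "\<dots> = (a + b) * N + 2 * b * i + (b * t + a * t) * M" unfolding t by algebra
    also have "b * t + a * t = b" using t by (simp add: algebra_simps)
    also have "(a + b) * N + 2 * b * i + b * M = a * N + b * (M + 2 * i + N)" by algebra
    finally show ?thesis .
  qed
  ultimately show ?thesis by (simp add: t_def)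
qed (simp add: parallel_sum_def)

lemma parallel_sum_norm_le:
  fixes p v :: "'a::real_inner"
  assumes "a + b > 0 \<or> a = 0 \<and> b = 0"
  shows "(a \<box> b) * (norm v)\<^sup>2 \<le> a * (norm p)\<^sup>2 + b * (norm (v + p))\<^sup>2"
proof -
  have "0 \<le> (a + b) * (norm (p + (b / (a + b)) *\<^sub>R v))\<^sup>2" using assms by auto
  then show ?thesis using parallel_sum_norm_bound[OF assms, of p v] by simp
qed

lemma binary_form_nonneg:
  fixes a b c x y :: real
  assumes "a \<ge> 0" "c \<ge> 0" "b\<^sup>2 \<le> a * c"
  shows "0 \<le> a * x\<^sup>2 + 2 * b * x * y + c * y\<^sup>2"
proof (cases "a = 0")
  case True
  with assms show ?thesis by simp
next
  case False
  with assms have a: "a > 0" by simp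
  have "0 \<le> (a * x + b * y)\<^sup>2 + (a * c - b\<^sup>2) * y\<^sup>2" using assms by simp
  also have "\<dots> = a * (a * x\<^sup>2 + 2 * b * x * y + c * y\<^sup>2)" by (simp add: algebra_simps power2_eq_square)
  finally show ?thesis using a by (simp add: zero_le_mult_iff)
qed

text \<open>The eigenvalues of \<open>[[p, -s], [-s, q]] * diag(u, w)\<close> are
  \<open>\<Delta> \<plusminus> sqrt (\<Delta>\<^sup>2 - u w (p q - s\<^sup>2))\<close>, where \<open>2 \<Delta> = p u + q w\<close>.\<close>

lemma weighted_form_ge:
  fixes p q s u w \<eta> :: real
  assumes pq: "p > 0" "q > 0" and s: "s\<^sup>2 < p * q"
    and rad: "0 \<le> \<Delta>\<^sup>2 - u * w * (p * q - s\<^sup>2)"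
    and eta: "\<eta> \<le> \<Delta> - sqrt (\<Delta>\<^sup>2 - u * w * (p * q - s\<^sup>2))"
    and Delta: "2 * \<Delta> = p * u + q * w"
  shows "\<eta> * (p * \<alpha>\<^sup>2 - 2 * s * \<alpha> * \<beta> + q * \<beta>\<^sup>2) \<le> u * (p * \<alpha> - s * \<beta>)\<^sup>2 + w * (q * \<beta> - s * \<alpha>)\<^sup>2"
proof -
  \<comment> \<open>The determinant of the block \<open>[[p, -s], [-s, q]]\<close>.\<close>
  define D where "D = p * q - s\<^sup>2"
  define th where "th = sqrt (\<Delta>\<^sup>2 - u * w * D)"
  have D: "0 < D" "D \<le> p * q" using s by (auto simp: D_def)
  have th: "th \<ge> 0" "th\<^sup>2 = \<Delta>\<^sup>2 - u * w * D" "\<eta> \<le> \<Delta> - th"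
    using rad eta by (auto simp: th_def D_def)
  have "th\<^sup>2 \<le> (\<Delta> - \<eta>)\<^sup>2" using th by (intro power_mono) auto
  then have quad: "0 \<le> \<eta>\<^sup>2 - 2 * \<Delta> * \<eta> + u * w * D"
    unfolding th(2) by (simp add: power2_eq_square algebra_simps)
  have amgm: "p * q * (u * w) \<le> \<Delta>\<^sup>2"
  proof -
    have "0 \<le> (p * u - q * w)\<^sup>2" by simp
    then have "4 * (p * q * (u * w)) \<le> (2 * \<Delta>)\<^sup>2"
      unfolding Delta by (simp add: power2_eq_square algebra_simps)
    then show ?thesis by (simp add: power2_eq_square)
  qed
  \<comment> \<open>Selects the sign branch below: the determinant condition alone would also allow
    \<open>a\<close> and \<open>c\<close> to be both negative. For \<open>\<eta> > 0\<close> the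
    bound comes from multiplying by the conjugate \<open>\<Delta> + th\<close>.\<close>
  have tr: "\<eta> * (p * q) \<le> D * \<Delta>"
  proof (cases "\<eta> \<le> 0")
    case True
    show ?thesis
    proof (cases "\<Delta> \<ge> 0")
      case True
      then have "0 \<le> D * \<Delta>" using D by simp
      moreover have "\<eta> * (p * q) \<le> 0" using \<open>\<eta> \<le> 0\<close> pq by (intro mult_nonpos_nonneg) auto
      ultimately show ?thesis by linarith
    next
      case False
      have "\<eta> * (p * q) \<le> \<Delta> * (p * q)" using th pq by (intro mult_right_mono) auto
      also have "\<dots> \<le> \<Delta> * D" using False D by (intro mult_left_mono_neg) auto
      finally show ?thesis by (simp add: mult.commute)
    qed
  next
    case False
    then have pos: "\<Delta> + th > 0" "\<Delta> > 0" using th by auto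
    have "\<eta> * (p * q) * (\<Delta> + th) \<le> (\<Delta> - th) * (p * q) * (\<Delta> + th)"
      using th pq pos by (intro mult_right_mono) auto
    also have "\<dots> = (p * q) * (\<Delta>\<^sup>2 - th\<^sup>2)" by (simp add: power2_eq_square algebra_simps)
    also have "\<dots> = D * (p * q * (u * w))" unfolding th(2) by simp
    also have "\<dots> \<le> D * \<Delta>\<^sup>2" using amgm D by (intro mult_left_mono) auto
    also have "\<dots> \<le> D * \<Delta> * (\<Delta> + th)" using D pos th by (simp add: power2_eq_square mult.assoc mult_left_mono)
    finally show ?thesis using pos by (simp add: mult_le_cancel_right)
  qed
  \<comment> \<open>The matrix \<open>[[a, - \<eta> * s], [- \<eta> * s, c]]\<close> represents
    \<open>D\<close> times the difference of the two sides in the coordinates \<open>v1\<close>,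
    \<open>v2\<close> introduced below, in which the inverse block expresses the form on the
    left.\<close>
  define a where "a = D * u - \<eta> * q"
  define c where "c = D * w - \<eta> * p"
  have "a * c - (\<eta> * s)\<^sup>2 = D * (\<eta>\<^sup>2 - 2 * \<Delta> * \<eta> + u * w * D)"
  proof -
    have "a * c - (\<eta> * s)\<^sup>2 = D * D * u * w - \<eta> * D * (p * u + q * w) + \<eta>\<^sup>2 * (p * q - s\<^sup>2)"
      by (simp add: a_def c_def power2_eq_square algebra_simps)
    then show ?thesis unfolding Delta[symmetric] D_def[symmetric]
      by (simp add: power2_eq_square algebra_simps)
  qed
  moreover have "0 \<le> D * (\<eta>\<^sup>2 - 2 * \<Delta> * \<eta> + u * w * D)" using quad D by simp
  ultimately have det: "(\<eta> * s)\<^sup>2 \<le> a * c" by linarith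
  have "p * a + q * c = D * (p * u + q * w) - 2 * (\<eta> * (p * q))"
    by (simp add: a_def c_def algebra_simps)
  also have "\<dots> \<ge> 0" unfolding Delta[symmetric] using tr by simp
  finally have sum: "0 \<le> p * a + q * c" .
  have "0 \<le> a * c" using det by (rule order_trans[rotated]) simp
  then have sgn: "0 \<le> a \<and> 0 \<le> c \<or> a \<le> 0 \<and> c \<le> 0" by (simp add: zero_le_mult_iff)
  have ac: "a \<ge> 0" "c \<ge> 0"
  proof -
    have "p * a < 0" if "a < 0" using that pq by (simp add: mult_pos_neg)
    moreover have "q * c < 0" if "c < 0" using that pq by (simp add: mult_pos_neg)
    moreover have "p * a \<le> 0" if "a \<le> 0" using that pq by (simp add: mult_nonneg_nonpos)
    moreover have "q * c \<le> 0" if "c \<le> 0" using that pq by (simp add: mult_nonneg_nonpos)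
    ultimately show "a \<ge> 0" "c \<ge> 0" using sgn sum by linarith+
  qed
  define v1 where "v1 = p * \<alpha> - s * \<beta>"
  define v2 where "v2 = q * \<beta> - s * \<alpha>"
  have "D * (p * \<alpha>\<^sup>2 - 2 * s * \<alpha> * \<beta> + q * \<beta>\<^sup>2) = q * v1\<^sup>2 + 2 * s * v1 * v2 + p * v2\<^sup>2"
    by (simp add: D_def v1_def v2_def power2_eq_square algebra_simps)
  note form = this
  have "D * (u * v1\<^sup>2 + w * v2\<^sup>2 - \<eta> * (p * \<alpha>\<^sup>2 - 2 * s * \<alpha> * \<beta> + q * \<beta>\<^sup>2))
      = D * (u * v1\<^sup>2 + w * v2\<^sup>2) - \<eta> * (D * (p * \<alpha>\<^sup>2 - 2 * s * \<alpha> * \<beta> + q * \<beta>\<^sup>2))"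
    by algebra
  also have "\<dots> = D * (u * v1\<^sup>2 + w * v2\<^sup>2) - \<eta> * (q * v1\<^sup>2 + 2 * s * v1 * v2 + p * v2\<^sup>2)"
    unfolding form ..
  also have "\<dots> = a * v1\<^sup>2 + 2 * (- (\<eta> * s)) * v1 * v2 + c * v2\<^sup>2"
    by (simp add: a_def c_def algebra_simps)
  also have "\<dots> \<ge> 0" using ac det by (intro binary_form_nonneg) auto
  finally show ?thesis using D by (simp add: zero_le_mult_iff v1_def v2_def)
qed

text \<open>The block has rank one here: both squares on the right are multiples, by
  \<open>p\<close> and by \<open>q\<close>, of the form on the left, so the trace
  \<open>p * u + q * w\<close> is the only eigenvalue that counts.\<close>

lemma weighted_form_ge_singular:
  fixes p q s u w \<eta> :: real
  assumes pq: "p > 0" "q > 0" and s: "s\<^sup>2 = p * q"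
    and eta: "\<eta> \<le> p * u + q * w"
  shows "\<eta> * (p * \<alpha>\<^sup>2 - 2 * s * \<alpha> * \<beta> + q * \<beta>\<^sup>2) \<le> u * (p * \<alpha> - s * \<beta>)\<^sup>2 + w * (q * \<beta> - s * \<alpha>)\<^sup>2"
proof -
  define f where "f = p * \<alpha>\<^sup>2 - 2 * s * \<alpha> * \<beta> + q * \<beta>\<^sup>2"
  have 1: "(p * \<alpha> - s * \<beta>)\<^sup>2 = p * f"
  proof -
    have "(p * \<alpha> - s * \<beta>)\<^sup>2 = p * (p * \<alpha>\<^sup>2 - 2 * s * \<alpha> * \<beta>) + s\<^sup>2 * \<beta>\<^sup>2"
      by (simp add: power2_eq_square algebra_simps)
    then show ?thesis unfolding s f_def by (simp add: algebra_simps)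
  qed
  have 2: "(q * \<beta> - s * \<alpha>)\<^sup>2 = q * f"
  proof -
    have "(q * \<beta> - s * \<alpha>)\<^sup>2 = q * (q * \<beta>\<^sup>2 - 2 * s * \<alpha> * \<beta>) + s\<^sup>2 * \<alpha>\<^sup>2"
      by (simp add: power2_eq_square algebra_simps)
    then show ?thesis unfolding s f_def by (simp add: algebra_simps)
  qed
  have "0 \<le> p * f" unfolding 1[symmetric] by simp
  then have "0 \<le> f" using pq by (simp add: zero_le_mult_iff)
  then have "\<eta> * f \<le> (p * u + q * w) * f" by (rule mult_right_mono[OF eta])
  then show ?thesis unfolding 1 2 f_def[symmetric] by (simp add: algebra_simps)
qed

text \<open>From \<open>(x - y)^2 = (x + y)^2 - 4 x y\<close> with
  \<open>x = bP / (2 * \<gamma>)\<close> and \<open>y = bD / (2 * \<tau>)\<close>. This is the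
  discriminant form in which the bound for a single block is stated.\<close>

lemma theta_alt:
  assumes "\<gamma> > 0" "\<tau> > 0"
  shows "theta bP bD \<gamma> \<tau> s
    = sqrt ((Delta bP bD \<gamma> \<tau>)\<^sup>2 - bP * bD * ((1 / \<gamma>) * (1 / \<tau>) - s\<^sup>2))"
  unfolding theta_def Delta_def using assms
  by (simp add: power2_eq_square field_simps)

lemma theta_mono:
  assumes "bP * bD \<ge> 0" "0 \<le> s" "s \<le> s'"
  shows "theta bP bD \<gamma> \<tau> s \<le> theta bP bD \<gamma> \<tau> s'"
  unfolding theta_def using assms by (intro real_sqrt_le_mono add_left_mono mult_left_mono power_mono) auto

lemma theta_antimono:
  assumes "bP * bD \<le> 0" "0 \<le> s" "s \<le> s'"
  shows "theta bP bD \<gamma> \<tau> s' \<le> theta bP bD \<gamma> \<tau> s"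
  unfolding theta_def using assms by (intro real_sqrt_le_mono add_left_mono mult_left_mono_neg power_mono) auto

text \<open>The root dominates \<open>|x - y|\<close> for the two summands \<open>x\<close>,
  \<open>y\<close> of \<open>Delta\<close>, and \<open>x + y - |x - y|\<close> is twice their
  minimum. This carries the kernel bounds in branches where \<open>eta'\<close> does not
  enter.\<close>

lemma Delta_minus_theta_le:
  assumes "bP * bD \<ge> 0"
  shows "Delta bP bD \<gamma> \<tau> - theta bP bD \<gamma> \<tau> s \<le> bP / \<gamma>"
    "Delta bP bD \<gamma> \<tau> - theta bP bD \<gamma> \<tau> s \<le> bD / \<tau>"
proof -
  have "\<bar>1 / (2 * \<gamma>) * bP - 1 / (2 * \<tau>) * bD\<bar> \<le> theta bP bD \<gamma> \<tau> s"
    unfolding theta_def using assms by (intro real_le_rsqrt) simp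
  then show "Delta bP bD \<gamma> \<tau> - theta bP bD \<gamma> \<tau> s \<le> bP / \<gamma>"
    "Delta bP bD \<gamma> \<tau> - theta bP bD \<gamma> \<tau> s \<le> bD / \<tau>"
    unfolding Delta_def by (auto simp: field_simps)
qed

text \<open>When both parallel sums are nonpositive, so is \<open>Delta\<close>, and the bound turns
  into \<open>2 * Delta \<le> Delta - theta\<close>.\<close>

lemma theta_le_abs_Delta:
  assumes "\<gamma> > 0" "\<tau> > 0" "bP * bD \<ge> 0" "s\<^sup>2 \<le> (1 / \<gamma>) * (1 / \<tau>)"
  shows "theta bP bD \<gamma> \<tau> s \<le> \<bar>Delta bP bD \<gamma> \<tau>\<bar>"
proof -
  have "0 \<le> bP * bD * ((1 / \<gamma>) * (1 / \<tau>) - s\<^sup>2)"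
    using assms by (intro mult_nonneg_nonneg[of "bP * bD"]) auto
  then show ?thesis unfolding theta_alt[OF assms(1,2)] by (intro real_le_lsqrt) auto
qed

text \<open>For parallel sums of opposite sign: \<open>Delta - theta \<le> 2 * Delta\<close> follows
  whatever the sign of \<open>Delta\<close>, which covers the degenerate block.\<close>

lemma abs_Delta_le_theta:
  assumes "\<gamma> > 0" "\<tau> > 0" "bP * bD \<le> 0" "s\<^sup>2 \<le> (1 / \<gamma>) * (1 / \<tau>)"
  shows "\<bar>Delta bP bD \<gamma> \<tau>\<bar> \<le> theta bP bD \<gamma> \<tau> s"
proof -
  have "bP * bD * ((1 / \<gamma>) * (1 / \<tau>) - s\<^sup>2) \<le> 0"
    using assms by (intro mult_nonpos_nonneg[of "bP * bD"]) auto
  then show ?thesis unfolding theta_alt[OF assms(1,2)] by (intro real_le_rsqrt) auto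
qed

text \<open>The radicand has two expressions: the one in \<open>theta\<close> is visibly nonnegative
  if \<open>bP * bD \<ge> 0\<close>, the one displayed here if the product is negative.\<close>

lemma theta_radicand_nonneg:
  assumes "s\<^sup>2 \<le> (1 / \<gamma>) * (1 / \<tau>)" "\<gamma> > 0" "\<tau> > 0"
  shows "0 \<le> (Delta bP bD \<gamma> \<tau>)\<^sup>2 - bP * bD * ((1 / \<gamma>) * (1 / \<tau>) - s\<^sup>2)"
proof (cases "bP * bD \<ge> 0")
  case True
  have "(Delta bP bD \<gamma> \<tau>)\<^sup>2 - bP * bD * ((1 / \<gamma>) * (1 / \<tau>) - s\<^sup>2)
      = (1 / (2 * \<gamma>) * bP - 1 / (2 * \<tau>) * bD)\<^sup>2 + bP * bD * s\<^sup>2"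
    unfolding Delta_def using assms by (simp add: power2_eq_square field_simps)
  then show ?thesis using True by simp
next
  case False
  then have "bP * bD * ((1 / \<gamma>) * (1 / \<tau>) - s\<^sup>2) \<le> 0"
    using assms by (intro mult_nonpos_nonneg[of "bP * bD"]) auto
  then show ?thesis by (smt (verit) zero_le_power2)
qed

lemma min_eta'_le:
  fixes L :: "real^'n^'m" and \<gamma> \<tau> \<rho>A \<mu>B t :: real
  defines "m \<equiv> \<lambda>t. real_of_ereal (min (ereal t) (eta' L \<rho>A \<mu>B \<gamma> \<tau>))"
  assumes "\<gamma> > 0" "\<tau> > 0"
  shows "m t \<le> t" "rank L < CARD('n) \<Longrightarrow> m t \<le> \<rho>A / \<gamma>" "rank L < CARD('m) \<Longrightarrow> m t \<le> \<mu>B / \<tau>"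
  using assms unfolding m_def eta'_def Let_def
  by (auto simp: min_def split: if_splits)

text \<open>The interface to the case list of \<open>eta_bar\<close>: one bound for each piece into
  which \<open>w\<close> decomposes, namely nondegenerate singular blocks, degenerate ones, the
  kernel of \<open>L\<close> and the kernel of \<open>transpose L\<close>. The rank conditions say
  that the kernel in question is nontrivial.\<close>

lemma eta_bar_le:
  fixes L :: "real^'n^'m" and \<gamma> \<tau> \<mu>A \<mu>B \<rho>A \<rho>B :: real
  assumes L: "L \<noteq> 0" and pos: "\<gamma> > 0" "\<tau> > 0" and gt: "\<gamma> * \<tau> \<le> 1 / (opnorm L)\<^sup>2"
    and mu: "\<mu>A + \<mu>B > 0 \<or> \<mu>A = 0 \<and> \<mu>B = 0"
    and rho: "\<rho>A + \<rho>B > 0 \<or> \<rho>A = 0 \<and> \<rho>B = 0"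
  defines "\<eta> \<equiv> eta_bar L \<mu>A \<mu>B \<rho>A \<rho>B \<gamma> \<tau>"
    and "bP \<equiv> \<rho>A \<box> \<rho>B" and "bD \<equiv> \<mu>A \<box> \<mu>B"
  shows "\<And>s. s \<in> pos_singular_values L \<Longrightarrow> s\<^sup>2 < (1 / \<gamma>) * (1 / \<tau>) \<Longrightarrow>
      \<eta> \<le> Delta bP bD \<gamma> \<tau> - theta bP bD \<gamma> \<tau> s"
    and "\<And>s. s \<in> pos_singular_values L \<Longrightarrow> s\<^sup>2 = (1 / \<gamma>) * (1 / \<tau>) \<Longrightarrow> \<eta> \<le> 2 * Delta bP bD \<gamma> \<tau>"
    and "rank L < CARD('n) \<Longrightarrow> \<eta> \<le> \<rho>A / \<gamma>"
    and "rank L < CARD('m) \<Longrightarrow> \<eta> \<le> \<mu>B / \<tau>"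
proof -
  let ?D = "Delta bP bD \<gamma> \<tau>" and ?th = "theta bP bD \<gamma> \<tau>" and ?d = "num_sv L"
  let ?m = "\<lambda>t. real_of_ereal (min (ereal t) (eta' L \<rho>A \<mu>B \<gamma> \<tau>))"
  let ?pq = "(1 / \<gamma>) * (1 / \<tau>)"
  note m = min_eta'_le[where L = L and \<rho>A = \<rho>A and \<mu>B = \<mu>B, OF pos]
  note op = opnorm_pos[OF L] opnorm_in_pos_singular_values[OF L]
  have op2: "(opnorm L)\<^sup>2 \<le> ?pq" using gt pos op by (simp add: field_simps)
  have s_pos: "s > 0" if "s \<in> pos_singular_values L" for s
    using that by (simp add: pos_singular_values_def)
  have s_op: "s\<^sup>2 \<le> (opnorm L)\<^sup>2" if "s \<in> pos_singular_values L" for s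
    using s_pos[OF that] pos_singular_value_le_opnorm[OF that] by (intro power_mono) auto
  have s_pq: "s\<^sup>2 \<le> ?pq" if "s \<in> pos_singular_values L" for s
    using s_op[OF that] op2 by (rule order_trans)
  note d1 = sv_num_sv_le(2)[OF op(2)]
  note svd = sv_num_sv_pos[OF d1]
  have svdpos: "sv L ?d > 0" using s_pos svd by simp
  have sgnP: "sgn bP = sgn (\<rho>A * \<rho>B)" and sgnD: "sgn bD = sgn (\<mu>A * \<mu>B)"
    unfolding bP_def bD_def by (intro sgn_parallel_sum rho mu)+
  have sgnPD: "sgn (bP * bD) = sgn (\<mu>A * \<mu>B * \<rho>A * \<rho>B)"
    using sgnP sgnD by (simp add: sgn_mult)
  have prod_nonneg: "bP * bD \<ge> 0 \<longleftrightarrow> \<mu>A * \<mu>B * \<rho>A * \<rho>B \<ge> 0"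
    using sgnPD by (metis linorder_not_le sgn_less)
  have posP: "0 < bP \<longleftrightarrow> 0 < \<rho>A * \<rho>B" and posD: "0 < bD \<longleftrightarrow> 0 < \<mu>A * \<mu>B"
    using sgnP sgnD by (metis sgn_greater)+
  have bP_le: "bP \<le> \<rho>A" and bD_le: "bD \<le> \<mu>B"
    unfolding bP_def bD_def by (intro parallel_sum_le rho mu)+
  have bP_le': "bP / \<gamma> \<le> \<rho>A / \<gamma>" and bD_le': "bD / \<tau> \<le> \<mu>B / \<tau>"
    using bP_le bD_le pos by (simp_all add: divide_right_mono)
  have D2: "2 * ?D = bP / \<gamma> + bD / \<tau>" by (simp add: Delta_def)
  have eta: "\<eta> = (if \<gamma> * \<tau> < 1 / (opnorm L)\<^sup>2 then
           (if \<mu>A * \<mu>B * \<rho>A * \<rho>B \<ge> 0 then ?D - ?th (opnorm L)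
            else ?m (?D - ?th (sv L ?d)))
         else if ?d = 1 then
           (if max (\<mu>A * \<mu>B) (\<rho>A * \<rho>B) \<le> 0 then 2 * ?D
            else ?m (2 * ?D))
         else
           (if max (\<mu>A * \<mu>B) (\<rho>A * \<rho>B) \<le> 0 then 2 * ?D
            else if min (\<mu>A * \<mu>B) (\<rho>A * \<rho>B) > 0 then ?D - ?th (sv L 2)
            else ?m (?D - ?th (sv L ?d))))"
    unfolding \<eta>_def eta_bar_def Let_def bP_def bD_def ..
  let ?C = "(\<forall>s. s \<in> pos_singular_values L \<longrightarrow> s\<^sup>2 < ?pq \<longrightarrow> \<eta> \<le> ?D - ?th s)
      \<and> (\<forall>s. s \<in> pos_singular_values L \<longrightarrow> s\<^sup>2 = ?pq \<longrightarrow> \<eta> \<le> 2 * ?D)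
      \<and> (rank L < CARD('n) \<longrightarrow> \<eta> \<le> \<rho>A / \<gamma>) \<and> (rank L < CARD('m) \<longrightarrow> \<eta> \<le> \<mu>B / \<tau>)"
  have ?C
  proof (cases "\<gamma> * \<tau> < 1 / (opnorm L)\<^sup>2")
    case True
    then have "(opnorm L)\<^sup>2 < ?pq" using pos op by (simp add: field_simps)
    then have ne: "s\<^sup>2 \<noteq> ?pq" if "s \<in> pos_singular_values L" for s
      using s_op[OF that] by linarith
    show ?thesis
    proof (cases "\<mu>A * \<mu>B * \<rho>A * \<rho>B \<ge> 0")
      \<comment> \<open>\<open>theta\<close> increases with the singular value, so
        \<open>opnorm L\<close> is the worst one.\<close>
      case prod: True
      then have bb: "bP * bD \<ge> 0" by (simp add: prod_nonneg)
      have "\<eta> = ?D - ?th (opnorm L)" using True prod eta by simp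
      then show ?thesis
        using theta_mono[OF bb] Delta_minus_theta_le[OF bb, of \<gamma> \<tau> "opnorm L"] ne bP_le' bD_le'
          s_pos pos_singular_value_le_opnorm
        by (smt (verit))
    next
      \<comment> \<open>\<open>theta\<close> decreases, so the smallest singular value is the worst
        one, and \<open>eta'\<close> supplies the kernel bounds.\<close>
      case prod: False
      then have bb: "bP * bD \<le> 0" using prod_nonneg by linarith
      have "\<eta> = ?m (?D - ?th (sv L ?d))" using True prod eta by simp
      then show ?thesis
        using theta_antimono[OF bb _ sv_num_sv_le(1)] svdpos m ne by (smt (verit))
    qed
  next
    case nlt: False
    have eq: "(opnorm L)\<^sup>2 = ?pq" using nlt gt pos op by (simp add: field_simps)
    have lt: "s < opnorm L" if "s \<in> pos_singular_values L" "s\<^sup>2 < ?pq" for s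
      using that eq op by (metis less_imp_le power_less_imp_less_base)
    show ?thesis
    proof (cases "max (\<mu>A * \<mu>B) (\<rho>A * \<rho>B) \<le> 0")
      case neg: True
      then have b: "bP \<le> 0" "bD \<le> 0" using posP posD by auto
      then have bb: "bP * bD \<ge> 0" by (simp add: mult_nonpos_nonpos)
      have np: "bP / \<gamma> \<le> 0" "bD / \<tau> \<le> 0" using b pos by (auto simp: divide_nonpos_pos)
      \<comment> \<open>Both summands of \<open>2 * ?D\<close> are nonpositive, so it lies below
        each of them; this gives the kernel bounds.\<close>
      have "\<eta> = 2 * ?D" using nlt neg eta by simp
      then show ?thesis
        using theta_le_abs_Delta[OF pos bb s_pq] D2 np bP_le' bD_le' by (smt (verit))
    next
      case nneg: False
      show ?thesis
      proof (cases "?d = 1")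
        case True
        \<comment> \<open>The only singular value is the degenerate one.\<close>
        have no: "\<not> s\<^sup>2 < ?pq" if "s \<in> pos_singular_values L" for s
        proof
          assume "s\<^sup>2 < ?pq"
          from lt[OF that this] have "s \<noteq> opnorm L" by simp
          moreover have "card (pos_singular_values L) = 1" using True by (simp add: num_sv_def)
          ultimately show False using that op(2) by (metis card_1_singletonE singletonD)
        qed
        have "\<eta> = ?m (2 * ?D)" using nlt nneg True eta by (simp only: if_True if_False simp_thms)
        then show ?thesis using m no by auto
      next
        case d: False
        show ?thesis
        proof (cases "min (\<mu>A * \<mu>B) (\<rho>A * \<rho>B) > 0")
          \<comment> \<open>Nondegenerate blocks belong to singular values below
            \<open>opnorm L\<close>, and \<open>theta\<close> increases, so \<open>sv L 2\<close> is
            the worst of them.\<close>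
          case True
          then have b: "bP > 0" "bD > 0" using posP posD by auto
          then have bb: "bP * bD \<ge> 0" by simp
          have "?D > 0" using D2 b pos by (smt (verit) divide_pos_pos)
          have e: "\<eta> = ?D - ?th (sv L 2)" using nlt nneg d True eta by simp
          have "?th (sv L 2) \<ge> 0" by (simp add: theta_def bb)
          then show ?thesis
            using theta_mono[OF bb _ pos_singular_value_le_sv_2[OF _ lt]]
              Delta_minus_theta_le[OF bb, of \<gamma> \<tau> "sv L 2"] bP_le' bD_le' s_pos \<open>?D > 0\<close> e
            by (smt (verit))
        next
          case mixed: False
          have "bP \<le> 0 \<and> bD \<ge> 0 \<or> bP \<ge> 0 \<and> bD \<le> 0"
            using mixed nneg posP posD by auto
          then have bb: "bP * bD \<le> 0" by (auto simp: mult_le_0_iff)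
          have "\<eta> = ?m (?D - ?th (sv L ?d))"
            using nlt nneg d mixed eta by (simp only: if_True if_False)
          then show ?thesis
            using theta_antimono[OF bb _ sv_num_sv_le(1)] svdpos m
              abs_Delta_le_theta[OF pos bb s_pq[OF svd]]
            by (smt (verit))
        qed
      qed
    qed
  qed
  then show "\<And>s. s \<in> pos_singular_values L \<Longrightarrow> s\<^sup>2 < (1 / \<gamma>) * (1 / \<tau>) \<Longrightarrow>
      \<eta> \<le> Delta bP bD \<gamma> \<tau> - theta bP bD \<gamma> \<tau> s"
    and "\<And>s. s \<in> pos_singular_values L \<Longrightarrow> s\<^sup>2 = (1 / \<gamma>) * (1 / \<tau>) \<Longrightarrow> \<eta> \<le> 2 * Delta bP bD \<gamma> \<tau>"
    and "rank L < CARD('n) \<Longrightarrow> \<eta> \<le> \<rho>A / \<gamma>"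
    and "rank L < CARD('m) \<Longrightarrow> \<eta> \<le> \<mu>B / \<tau>"
    by blast+
qed

section \<open>The preconditioner and the primal-dual operator\<close>

text \<open>The form stays nonnegative after a step of length \<open>1 / K\<close> along
  \<open>- f x\<close>, which limits the decrease of that step. This turns convergence in a
  degenerate seminorm into norm convergence of the images under \<open>f\<close>.\<close>

lemma selfadjoint_psd_norm_le:
  fixes f :: "'a::euclidean_space \<Rightarrow> 'a"
  assumes lin: "linear f" and sym: "\<And>x y. f x \<bullet> y = x \<bullet> f y" and psd: "\<And>x. 0 \<le> x \<bullet> f x"
  obtains K where "K > 0" "\<And>x. (norm (f x))\<^sup>2 \<le> K * (x \<bullet> f x)"
proof -
  obtain K where K: "K > 0" "\<And>x. norm (f x) \<le> K * norm x"
    using linear_bounded_pos[OF lin] by blast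
  show thesis
  proof (rule that[OF K(1)])
    fix x
    define y where "y = x - (1 / K) *\<^sub>R f x"
    have "f x \<bullet> f (f x) \<le> norm (f x) * (K * norm (f x))"
      using norm_cauchy_schwarz[of "f x" "f (f x)"] mult_left_mono[OF K(2)[of "f x"], of "norm (f x)"]
      by simp
    then have 1: "f x \<bullet> f (f x) \<le> K * (norm (f x))\<^sup>2" by (simp add: power2_eq_square algebra_simps)
    have "0 \<le> y \<bullet> f y" by (rule psd)
    also have "y \<bullet> f y = x \<bullet> f x - 2 * (1 / K) * (norm (f x))\<^sup>2 + (1 / K)\<^sup>2 * (f x \<bullet> f (f x))"
      using sym[of x "f x"] unfolding y_def power2_norm_eq_inner
      by (simp add: linear_diff[OF lin] linear_cmul[OF lin] inner_diff power2_eq_square diff_divide_distrib)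
    also have "\<dots> \<le> x \<bullet> f x - 2 * (1 / K) * (norm (f x))\<^sup>2 + (1 / K)\<^sup>2 * (K * (norm (f x))\<^sup>2)"
      using 1 by (intro add_left_mono mult_left_mono) auto
    also have "\<dots> = x \<bullet> f x - (norm (f x))\<^sup>2 / K"
      using K(1) by (simp add: power2_eq_square field_simps)
    finally show "(norm (f x))\<^sup>2 \<le> K * (x \<bullet> f x)" using K(1) by (simp add: pos_divide_le_eq mult.commute)
  qed
qed

lemma closest_point_subspace_orthogonal:
  fixes S :: "'a::euclidean_space set"
  assumes S: "subspace S" and u: "u \<in> S"
  shows "(z - closest_point S z) \<bullet> u = 0"
proof -
  let ?c = "closest_point S z"
  have c: "?c \<in> S"
    using S subspace_0[OF S] by (intro closest_point_in_set closed_subspace) auto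
  have le: "(z - ?c) \<bullet> w \<le> 0" if "w \<in> S" for w
    using closest_point_dot[OF subspace_imp_convex[OF S] closed_subspace[OF S], of "?c + w" z]
      that c subspace_add[OF S] by simp
  show ?thesis using le[OF u] le[OF subspace_neg[OF S u]] by simp
qed

text \<open>Self-adjointness makes the range the orthogonal complement of the kernel: the part
  removed by the projection is killed by \<open>f\<close>, and \<open>f\<close> is injective, hence
  bounded below, on its range. The last clause passes control of \<open>P\<close> on to the
  projections.\<close>

lemma closest_point_range_selfadjoint:
  fixes f :: "'a::euclidean_space \<Rightarrow> 'a"
  assumes lin: "linear f" and sym: "\<And>x y. f x \<bullet> y = x \<bullet> f y"
  defines "c \<equiv> closest_point (range f)"
  shows "f (c z) = f z" and "(z - c z) \<bullet> f u = 0"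
    and "\<exists>e>0. \<forall>z w. e * norm (c z - c w) \<le> norm (f (z - w))"
proof -
  have S: "subspace (range f)" using lin by (simp add: linear_subspace_image)
  show orth: "(z - c z) \<bullet> f u = 0" for z u
    unfolding c_def by (rule closest_point_subspace_orthogonal[OF S]) simp
  show fc: "f (c z) = f z" for z
  proof -
    have "f (z - c z) \<bullet> f (z - c z) = 0" by (simp add: sym orth)
    then show ?thesis by (simp add: linear_diff[OF lin])
  qed
  have inj: "u = 0" if "u \<in> range f" "f u = 0" for u
  proof -
    from that obtain t where "u = f t" by blast
    then have "u \<bullet> u = f u \<bullet> t" by (simp add: sym)
    then show ?thesis using that by simp
  qed
  have "bounded_linear f" using lin by (simp add: linear_conv_bounded_linear)
  then obtain e where e: "e > 0" "\<And>u. u \<in> range f \<Longrightarrow> e * norm u \<le> norm (f u)"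
    using injective_imp_isometric[OF closed_subspace[OF S] S] inj by meson
  have mem: "c z \<in> range f" for z
    unfolding c_def by (intro closest_point_in_set closed_subspace S) auto
  have "e * norm (c z - c w) \<le> norm (f (z - w))" for z w
    using e(2)[OF subspace_diff[OF S mem mem], of z w] by (simp add: linear_diff[OF lin] fc)
  with e(1) show "\<exists>e>0. \<forall>z w. e * norm (c z - c w) \<le> norm (f (z - w))" by blast
qed

lemma linear_P_op: "linear (P_op L \<gamma> \<tau>)"
  by (rule linearI)
    (auto simp: P_op_def matrix_vector_right_distrib matrix_vector_mult_scaleR algebra_simps)

lemma P_op_selfadjoint: "P_op L \<gamma> \<tau> z \<bullet> w = z \<bullet> P_op L \<gamma> \<tau> w"
  using matrix_transpose_inner[of L "fst z" "snd w"] matrix_transpose_inner[of L "fst w" "snd z"]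
  by (cases z; cases w) (simp add: P_op_def inner_diff inner_add inner_commute)

lemma P_op_quadratic:
  "(a, b) \<bullet> P_op L \<gamma> \<tau> (a, b)
    = (1 / \<gamma>) * (norm a)\<^sup>2 - 2 * ((L *v a) \<bullet> b) + (1 / \<tau>) * (norm b)\<^sup>2"
  using matrix_transpose_inner[of L a b]
  by (simp add: P_op_def inner_diff inner_add inner_commute power2_norm_eq_inner)

text \<open>Cauchy-Schwarz reduces the form to a binary one in the norms of the components; the
  stepsize bound is its discriminant condition.\<close>

lemma P_op_psd:
  assumes "\<gamma> > 0" "\<tau> > 0" "(opnorm L)\<^sup>2 \<le> (1 / \<gamma>) * (1 / \<tau>)"
  shows "0 \<le> z \<bullet> P_op L \<gamma> \<tau> z"
proof -
  obtain a b where z: "z = (a, b)" by (cases z)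
  have op: "0 \<le> opnorm L" by (rule onorm_pos_le) simp
  have "(L *v a) \<bullet> b \<le> norm (L *v a) * norm b" by (rule norm_cauchy_schwarz)
  also have "\<dots> \<le> opnorm L * norm a * norm b" by (intro mult_right_mono opnorm_bound) simp
  finally have 1: "(L *v a) \<bullet> b \<le> opnorm L * norm a * norm b" .
  have "0 \<le> (1 / \<gamma>) * (norm a)\<^sup>2 + 2 * (- opnorm L) * norm a * norm b + (1 / \<tau>) * (norm b)\<^sup>2"
    using assms by (intro binary_form_nonneg) auto
  also have "\<dots> \<le> (1 / \<gamma>) * (norm a)\<^sup>2 - 2 * ((L *v a) \<bullet> b) + (1 / \<tau>) * (norm b)\<^sup>2"
    using 1 by simp
  finally show ?thesis unfolding z P_op_quadratic .
qed

lemma orthogonal_decomposition_range: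
  fixes L :: "real^'n^'m"
  obtains c n where "a = transpose L *v c + n" "L *v n = 0"
proof -
  have S: "subspace (range ((*v) (transpose L)))" by (simp add: linear_subspace_image)
  obtain y n where "y \<in> span (range ((*v) (transpose L)))"
    "\<And>w. w \<in> span (range ((*v) (transpose L))) \<Longrightarrow> orthogonal n w" "a = y + n"
    using orthogonal_subspace_decomp_exists by blast
  then obtain c where c: "a = transpose L *v c + n"
    and o: "\<And>w. n \<bullet> (transpose L *v w) = 0"
    unfolding span_eq_iff[THEN iffD2, OF S] by (auto simp: orthogonal_def)
  have "(L *v n) \<bullet> (L *v n) = 0" using o by (simp add: matrix_transpose_inner)
  then show thesis using c that by simp
qed

text \<open>The coupling is skew: \<open>dx \<bullet> L^T dy\<close> and
  \<open>dy \<bullet> L dx\<close> cancel when the two graph inequalities are added. The inequality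
  for \<open>A\<close> alone serves the case of vanishing moduli.\<close>

lemma T_PD_semimonotone:
  fixes L :: "real^'n^'m"
  assumes A: "semimonotone_at (\<mu>A *\<^sub>R (transpose L ** L)) (\<rho>A *\<^sub>R mat 1) A xs (- (transpose L *v ys))"
    and B: "semimonotone_at (\<mu>B *\<^sub>R mat 1) (\<rho>B *\<^sub>R (L ** transpose L)) B (L *v xs) ys"
    and T: "(v1, v2) \<in> T_PD L A B (x, y)"
  defines "dx \<equiv> x - xs" and "dy \<equiv> y - ys"
  shows "\<mu>A * (norm (L *v dx))\<^sup>2 + \<rho>A * (norm (v1 - transpose L *v dy))\<^sup>2 \<le> dx \<bullet> (v1 - transpose L *v dy)"
    and "\<mu>B * (norm (v2 + L *v dx))\<^sup>2 + \<rho>B * (norm (transpose L *v dy))\<^sup>2 \<le> dy \<bullet> (v2 + L *v dx)"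
    and "\<mu>A * (norm (L *v dx))\<^sup>2 + \<mu>B * (norm (v2 + L *v dx))\<^sup>2
      + (\<rho>B * (norm (transpose L *v dy))\<^sup>2 + \<rho>A * (norm (v1 - transpose L *v dy))\<^sup>2)
      \<le> (x - xs, y - ys) \<bullet> (v1, v2)"
proof -
  from T obtain u w where u: "u \<in> A x" "v1 = u + transpose L *v y" and w: "y \<in> B w" "v2 = w - L *v x"
    by (auto simp: T_PD_def inv_op_def)
  have 1: "u - - (transpose L *v ys) = v1 - transpose L *v dy"
    by (simp add: u dy_def matrix_vector_mult_diff_distrib)
  have 2: "w - L *v xs = v2 + L *v dx"
    by (simp add: w dx_def matrix_vector_mult_diff_distrib)
  have e1: "a \<bullet> ((c *\<^sub>R (transpose L ** L)) *v a) = c * (norm (L *v a))\<^sup>2" for a c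
    by (simp add: scaleR_matrix_vector_assoc[symmetric] matrix_vector_mul_assoc[symmetric]
        matrix_transpose_inner[symmetric] power2_norm_eq_inner)
  have e2: "a \<bullet> ((c *\<^sub>R (L ** transpose L)) *v a) = c * (norm (transpose L *v a))\<^sup>2" for a c
    using matrix_transpose_inner[of "transpose L" a "transpose L *v a"]
    by (simp add: scaleR_matrix_vector_assoc[symmetric] matrix_vector_mul_assoc[symmetric]
        power2_norm_eq_inner)
  have e3: "a \<bullet> ((c *\<^sub>R mat 1) *v a) = c * (norm a)\<^sup>2" for a :: "real^'z" and c
    by (simp add: scaleR_matrix_vector_assoc[symmetric] power2_norm_eq_inner)
  have "(x - xs) \<bullet> (u - - (transpose L *v ys))
      \<ge> (x - xs) \<bullet> ((\<mu>A *\<^sub>R (transpose L ** L)) *v (x - xs))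
        + (u - - (transpose L *v ys)) \<bullet> ((\<rho>A *\<^sub>R mat 1) *v (u - - (transpose L *v ys)))"
    using A u(1) unfolding semimonotone_at_def gph_def by blast
  then show r1: "\<mu>A * (norm (L *v dx))\<^sup>2 + \<rho>A * (norm (v1 - transpose L *v dy))\<^sup>2
      \<le> dx \<bullet> (v1 - transpose L *v dy)"
    unfolding 1 e1 e3 dx_def by simp
  have "(w - L *v xs) \<bullet> (y - ys)
      \<ge> (w - L *v xs) \<bullet> ((\<mu>B *\<^sub>R mat 1) *v (w - L *v xs))
        + (y - ys) \<bullet> ((\<rho>B *\<^sub>R (L ** transpose L)) *v (y - ys))"
    using B w(1) unfolding semimonotone_at_def gph_def by blast
  then show r2: "\<mu>B * (norm (v2 + L *v dx))\<^sup>2 + \<rho>B * (norm (transpose L *v dy))\<^sup>2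
      \<le> dy \<bullet> (v2 + L *v dx)"
    unfolding 2 e2 e3 dy_def by (simp add: inner_commute)
  have "dx \<bullet> (v1 - transpose L *v dy) + dy \<bullet> (v2 + L *v dx) = (x - xs, y - ys) \<bullet> (v1, v2)"
    using matrix_transpose_inner[of L dx dy]
    by (simp add: inner_diff_right inner_add_right inner_commute flip: dx_def dy_def)
  with r1 r2 show "\<mu>A * (norm (L *v dx))\<^sup>2 + \<mu>B * (norm (v2 + L *v dx))\<^sup>2
      + (\<rho>B * (norm (transpose L *v dy))\<^sup>2 + \<rho>A * (norm (v1 - transpose L *v dy))\<^sup>2)
      \<le> (x - xs, y - ys) \<bullet> (v1, v2)"
    by linarith
qed

lemma parallel_sum_commute: "a \<box> b = b \<box> a"
  by (simp add: parallel_sum_def add.commute mult.commute)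

lemma norm_square_add_orthogonal:
  "u \<bullet> v = 0 \<Longrightarrow> (norm (u + v))\<^sup>2 = (norm u)\<^sup>2 + (norm v)\<^sup>2"
  by (rule norm_add_Pythagorean) (simp add: orthogonal_def)

text \<open>The vectors \<open>L^T dy\<close> and \<open>L dx\<close> lie in the ranges of
  \<open>transpose L\<close> and \<open>L\<close>, so the kernel parts \<open>a0\<close> and
  \<open>b0\<close> split off by Pythagoras. What remains lives on the ranges, where the singular
  blocks apply.\<close>

lemma eta_bar_form_le:
  fixes L :: "real^'n^'m" and \<gamma> \<tau> \<mu>A \<mu>B \<rho>A \<rho>B :: real
  assumes L: "L \<noteq> 0" and pos: "\<gamma> > 0" "\<tau> > 0" and gt: "\<gamma> * \<tau> \<le> 1 / (opnorm L)\<^sup>2"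
    and mu: "\<mu>A + \<mu>B > 0 \<or> \<mu>A = 0 \<and> \<mu>B = 0"
    and rho: "\<rho>A + \<rho>B > 0 \<or> \<rho>A = 0 \<and> \<rho>B = 0"
    and Pw: "P_op L \<gamma> \<tau> w = (v1, v2)"
  shows "eta_bar L \<mu>A \<mu>B \<rho>A \<rho>B \<gamma> \<tau> * (w \<bullet> P_op L \<gamma> \<tau> w)
    \<le> \<mu>A * (norm (L *v dx))\<^sup>2 + \<mu>B * (norm (v2 + L *v dx))\<^sup>2
      + (\<rho>B * (norm (transpose L *v dy))\<^sup>2 + \<rho>A * (norm (v1 - transpose L *v dy))\<^sup>2)"
proof -
  define p where "p = 1 / \<gamma>"
  define q where "q = 1 / \<tau>"
  define \<eta> where "\<eta> = eta_bar L \<mu>A \<mu>B \<rho>A \<rho>B \<gamma> \<tau>"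
  define bP where "bP = \<rho>A \<box> \<rho>B"
  define bD where "bD = \<mu>A \<box> \<mu>B"
  note eta = eta_bar_le[OF L pos gt mu rho, folded \<eta>_def bP_def bD_def]
  have pq: "p > 0" "q > 0" using pos by (auto simp: p_def q_def)
  have Delta: "2 * Delta bP bD \<gamma> \<tau> = p * bP + q * bD" by (simp add: Delta_def p_def q_def)
  have op2: "(opnorm L)\<^sup>2 \<le> p * q" using gt pos opnorm_pos[OF L] by (simp add: p_def q_def field_simps)
  have scalar: "\<eta> * (p * \<alpha>\<^sup>2 - 2 * s * \<alpha> * \<beta> + q * \<beta>\<^sup>2)
      \<le> bP * (p * \<alpha> - s * \<beta>)\<^sup>2 + bD * (q * \<beta> - s * \<alpha>)\<^sup>2"
    if s: "s \<in> pos_singular_values L" for s \<alpha> \<beta>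
  proof -
    have "s > 0" using s by (simp add: pos_singular_values_def)
    then have "s\<^sup>2 \<le> (opnorm L)\<^sup>2" using pos_singular_value_le_opnorm[OF s] by (intro power_mono) auto
    with op2 have le: "s\<^sup>2 \<le> p * q" by simp
    show ?thesis
    proof (cases "s\<^sup>2 = p * q")
      case True
      then have "\<eta> \<le> p * bP + q * bD" using eta(2)[OF s] Delta by (simp add: p_def q_def)
      then show ?thesis by (rule weighted_form_ge_singular[OF pq True])
    next
      case False
      then have lt: "s\<^sup>2 < p * q" using le by simp
      show ?thesis
      proof (rule weighted_form_ge[OF pq lt _ _ Delta])
        show "0 \<le> (Delta bP bD \<gamma> \<tau>)\<^sup>2 - bP * bD * (p * q - s\<^sup>2)"
          using theta_radicand_nonneg[OF _ pos, of s] le unfolding p_def q_def by blast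
        show "\<eta> \<le> Delta bP bD \<gamma> \<tau> - sqrt ((Delta bP bD \<gamma> \<tau>)\<^sup>2 - bP * bD * (p * q - s\<^sup>2))"
          using eta(1)[OF s] lt unfolding theta_alt[OF pos] p_def q_def by blast
      qed
    qed
  qed
  obtain a b where w: "w = (a, b)" by (cases w)
  obtain c a0 where a: "a = transpose L *v c + a0" and a0: "L *v a0 = 0"
    by (rule orthogonal_decomposition_range)
  obtain c' b0 where b': "b = L *v c' + b0" and b0: "transpose L *v b0 = 0"
    using orthogonal_decomposition_range[of b "transpose L"] by auto
  \<comment> \<open>The preimage is reduced modulo the kernel of \<open>L\<close>, so that
    \<open>b1\<close> is the image of a vector in the row space, where \<open>L\<close> is
    injective.\<close>
  obtain c'' n where c': "c' = transpose L *v c'' + n" and n: "L *v n = 0"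
    by (rule orthogonal_decomposition_range)
  define a1 where "a1 = transpose L *v c"
  define b1 where "b1 = L *v (transpose L *v c'')"
  have ab: "a = a1 + a0" "b = b1 + b0"
    by (simp_all add: a a1_def b' b1_def c' n matrix_vector_right_distrib)
  define u1 where "u1 = p *\<^sub>R a1 - transpose L *v b1"
  define u2 where "u2 = q *\<^sub>R b1 - L *v a1"
  have v1: "v1 = p *\<^sub>R a0 + u1" and v2: "v2 = q *\<^sub>R b0 + u2"
    using Pw by (auto simp: w ab P_op_def u1_def u2_def p_def q_def matrix_vector_right_distrib
        a0 b0 algebra_simps)
  have form: "\<eta> * (p * (norm a1)\<^sup>2 - 2 * ((L *v a1) \<bullet> b1) + q * (norm b1)\<^sup>2)
    \<le> bP * (norm u1)\<^sup>2 + bD * (norm u2)\<^sup>2"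
    unfolding u1_def u2_def b1_def a1_def
  proof (rule singular_value_form_le[OF scalar])
    let ?V = "range ((*v) (transpose L))"
    show "subspace ?V" by (simp add: linear_subspace_image)
    show "x = 0" if "x \<in> ?V" "L *v x = 0" for x
    proof -
      from that(1) obtain t where "x = transpose L *v t" by blast
      then have "x \<bullet> x = (L *v x) \<bullet> t" by (simp add: matrix_transpose_inner)
      then show ?thesis using that(2) by simp
    qed
  qed auto
  have orthA: "a0 \<bullet> (transpose L *v t) = 0" for t
    using a0 matrix_transpose_inner[of L a0 t] by simp
  have orthB: "b0 \<bullet> (L *v t) = 0" for t
    using b0 matrix_transpose_inner[of L t b0] by (simp add: inner_commute)
  have na: "(norm a)\<^sup>2 = (norm a1)\<^sup>2 + (norm a0)\<^sup>2" and nb: "(norm b)\<^sup>2 = (norm b1)\<^sup>2 + (norm b0)\<^sup>2"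
    unfolding ab a1_def b1_def
    by (intro norm_square_add_orthogonal; simp add: orthA orthB inner_commute[of _ a0] inner_commute[of _ b0])+
  have "(L *v a) \<bullet> b = (L *v a1) \<bullet> b1"
    using orthB[of a1] by (simp add: ab a0 matrix_vector_right_distrib inner_add inner_commute)
  then have wPw: "w \<bullet> P_op L \<gamma> \<tau> w = p * (norm a1)\<^sup>2 - 2 * ((L *v a1) \<bullet> b1) + q * (norm b1)\<^sup>2
      + p * (norm a0)\<^sup>2 + q * (norm b0)\<^sup>2"
    unfolding w P_op_quadratic na nb by (simp add: p_def q_def algebra_simps)
  define k where "k = transpose L *v dy"
  define h where "h = L *v dx"
  have "u1 - k = transpose L *v (p *\<^sub>R c - b1 - dy)"
    by (simp add: u1_def a1_def k_def matrix_vector_mult_diff_distrib matrix_vector_mult_scaleR)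
  then have "a0 \<bullet> (u1 - k) = 0" by (simp add: orthA)
  then have nv1: "(norm (v1 - k))\<^sup>2 = p\<^sup>2 * (norm a0)\<^sup>2 + (norm (u1 - k))\<^sup>2"
    using norm_square_add_orthogonal[of "p *\<^sub>R a0" "u1 - k"]
    by (simp add: v1 power_mult_distrib add_diff_eq)
  have "u2 + h = L *v (q *\<^sub>R transpose L *v c'' - a1 + dx)"
    by (simp add: u2_def b1_def h_def matrix_vector_mult_diff_distrib matrix_vector_right_distrib
        matrix_vector_mult_scaleR scaleR_matrix_vector_assoc[symmetric])
  then have nv2: "(norm (v2 + h))\<^sup>2 = q\<^sup>2 * (norm b0)\<^sup>2 + (norm (u2 + h))\<^sup>2"
    using norm_square_add_orthogonal[of "q *\<^sub>R b0" "u2 + h"] orthB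
    by (simp add: v2 power_mult_distrib add.assoc)
  have A0: "\<eta> * (p * (norm a0)\<^sup>2) \<le> \<rho>A * (p\<^sup>2 * (norm a0)\<^sup>2)"
  proof (cases "a0 = 0")
    case False
    then have "rank L < CARD('n)"
      using a0 rank_bound[of L] matrix_nonfull_linear_equations_eq[of L] by (metis min.boundedE le_neq_implies_less)
    then have "\<eta> \<le> \<rho>A * p" using eta(3) by (simp add: p_def)
    then have "\<eta> * (p * (norm a0)\<^sup>2) \<le> \<rho>A * p * (p * (norm a0)\<^sup>2)"
      using pq by (intro mult_right_mono) auto
    then show ?thesis by (simp add: power2_eq_square algebra_simps)
  qed simp
  have B0: "\<eta> * (q * (norm b0)\<^sup>2) \<le> \<mu>B * (q\<^sup>2 * (norm b0)\<^sup>2)"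
  proof (cases "b0 = 0")
    case False
    then have "rank L < CARD('m)"
      using b0 rank_bound[of L] matrix_nonfull_linear_equations_eq[of "transpose L"]
      by (metis min.boundedE le_neq_implies_less rank_transpose)
    then have "\<eta> \<le> \<mu>B * q" using eta(4) by (simp add: q_def)
    then have "\<eta> * (q * (norm b0)\<^sup>2) \<le> \<mu>B * q * (q * (norm b0)\<^sup>2)"
      using pq by (intro mult_right_mono) auto
    then show ?thesis by (simp add: power2_eq_square algebra_simps)
  qed simp
  \<comment> \<open>The minimisation is over \<open>- k\<close>, whose own weight is
    \<open>\<rho>B\<close>; hence the commuted parallel sum.\<close>
  have "bP * (norm u1)\<^sup>2 \<le> \<rho>B * (norm (- k))\<^sup>2 + \<rho>A * (norm (u1 + - k))\<^sup>2"
    unfolding bP_def parallel_sum_commute[of \<rho>A] using rho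
    by (intro parallel_sum_norm_le) (auto simp: add.commute)
  then have C1: "bP * (norm u1)\<^sup>2 \<le> \<rho>B * (norm k)\<^sup>2 + \<rho>A * (norm (u1 - k))\<^sup>2" by simp
  have C2: "bD * (norm u2)\<^sup>2 \<le> \<mu>A * (norm h)\<^sup>2 + \<mu>B * (norm (u2 + h))\<^sup>2"
    unfolding bD_def by (rule parallel_sum_norm_le[OF mu])
  show ?thesis
    unfolding \<eta>_def[symmetric] k_def[symmetric] h_def[symmetric] nv1 nv2 wPw
    using A0 B0 C1 C2 form by (simp only: distrib_left)
qed

section \<open>Convergence\<close>

lemma in_resolvent_scale_op:
  "x \<in> resolvent (scale_op c A) s \<longleftrightarrow> (\<exists>u\<in>A x. s = x + c *\<^sub>R u)"
  by (auto simp: resolvent_def inv_op_def scale_op_def)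

lemma in_T_PD_iff:
  "(v1, v2) \<in> T_PD L A B (x, y) \<longleftrightarrow>
    (x, v1 - transpose L *v y) \<in> gph A \<and> (v2 + L *v x, y) \<in> gph B"
proof -
  have 1: "v1 \<in> (\<lambda>u. u + c) ` U \<longleftrightarrow> v1 - c \<in> U" for c U
    by (auto intro: image_eqI[of _ _ "v1 - c"])
  have 2: "v2 \<in> (\<lambda>u. u - c) ` U \<longleftrightarrow> v2 + c \<in> U" for c U
    by (auto intro: image_eqI[of _ _ "v2 + c"])
  show ?thesis by (simp add: T_PD_def 1 2 inv_op_def gph_def)
qed

lemma T_PD_closed:
  assumes "outer_semicontinuous A" "outer_semicontinuous B"
    and T: "\<And>k. v k \<in> T_PD L A B (z k)" and lim: "z \<longlonglongrightarrow> z'" "v \<longlonglongrightarrow> v'"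
  shows "v' \<in> T_PD L A B z'"
proof -
  have A: "closed (gph A)" and B: "closed (gph B)"
    using assms by (simp_all add: outer_semicontinuous_def)
  have T': "(fst (v k), snd (v k)) \<in> T_PD L A B (fst (z k), snd (z k))" for k using T by simp
  have 1: "(fst (z k), fst (v k) - transpose L *v snd (z k)) \<in> gph A"
    and 2: "(snd (v k) + L *v fst (z k), snd (z k)) \<in> gph B" for k
    using T'[of k] unfolding in_T_PD_iff by blast+
  have "(\<lambda>k. (fst (z k), fst (v k) - transpose L *v snd (z k))) \<longlonglongrightarrow> (fst z', fst v' - transpose L *v snd z')"
    by (intro tendsto_intros lim bounded_linear.tendsto[OF matrix_vector_mul_bounded_linear])
  with A 1 have "(fst z', fst v' - transpose L *v snd z') \<in> gph A"
    by (rule closed_sequentially)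
  moreover have "(\<lambda>k. (snd (v k) + L *v fst (z k), snd (z k))) \<longlonglongrightarrow> (snd v' + L *v fst z', snd z')"
    by (intro tendsto_intros lim bounded_linear.tendsto[OF matrix_vector_mul_bounded_linear])
  with B 2 have "(snd v' + L *v fst z', snd z') \<in> gph B"
    by (rule closed_sequentially)
  ultimately have "(fst v', snd v') \<in> T_PD L A B (fst z', snd z')" unfolding in_T_PD_iff by blast
  then show ?thesis by simp
qed

text \<open>The extrapolation in the second resolvent matches the off-diagonal entry of
  \<open>P\<close>: \<open>L *v (2 *\<^sub>R xbar k - x k)\<close> and
  \<open>L *v (x k - xbar k)\<close> add up to \<open>L *v xbar k\<close>.\<close>

lemma CPA_step_in_T_PD:
  assumes "CPA L A B \<gamma> \<tau> lam x y xbar ybar" "\<gamma> > 0" "\<tau> > 0"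
  shows "P_op L \<gamma> \<tau> ((x k, y k) - (xbar k, ybar k)) \<in> T_PD L A B (xbar k, ybar k)"
proof -
  have "xbar k \<in> resolvent (scale_op \<gamma> A) (x k - \<gamma> *\<^sub>R (transpose L *v y k))"
    and "ybar k \<in> resolvent (scale_op \<tau> (inv_op B)) (y k + \<tau> *\<^sub>R (L *v (2 *\<^sub>R xbar k - x k)))"
    using assms(1) by (auto simp: CPA_def)
  then obtain u w where u: "u \<in> A (xbar k)" "x k - \<gamma> *\<^sub>R (transpose L *v y k) = xbar k + \<gamma> *\<^sub>R u"
    and w: "w \<in> inv_op B (ybar k)"
      "y k + \<tau> *\<^sub>R (L *v (2 *\<^sub>R xbar k - x k)) = ybar k + \<tau> *\<^sub>R w"
    unfolding in_resolvent_scale_op by blast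
  have "x k - xbar k = \<gamma> *\<^sub>R (u + transpose L *v y k)"
    using u(2) by (simp add: algebra_simps)
  then have 1: "(1 / \<gamma>) *\<^sub>R (x k - xbar k) = u + transpose L *v y k" using assms(2) by simp
  have "y k - ybar k = \<tau> *\<^sub>R (w - L *v (2 *\<^sub>R xbar k - x k))"
    using w(2) by (simp add: algebra_simps)
  then have 2: "(1 / \<tau>) *\<^sub>R (y k - ybar k) = w - L *v (2 *\<^sub>R xbar k - x k)" using assms(3) by simp
  have 3: "L *v (2 *\<^sub>R xbar k - x k) = (L *v xbar k + L *v xbar k) - L *v x k"
    by (simp only: scaleR_2 matrix_vector_mult_diff_distrib matrix_vector_right_distrib)
  have "- (a - b) + (w - ((b + b) - a)) = w - b" for a b w :: "'z::ab_group_add"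
    by (simp add: algebra_simps)
  then have 4: "- (L *v (x k - xbar k)) + (w - L *v (2 *\<^sub>R xbar k - x k)) = w - L *v xbar k"
    unfolding 3 unfolding matrix_vector_mult_diff_distrib by blast
  have 5: "u + transpose L *v y k - transpose L *v (y k - ybar k) = u + transpose L *v ybar k"
    by (simp add: matrix_vector_mult_diff_distrib)
  have "P_op L \<gamma> \<tau> ((x k, y k) - (xbar k, ybar k)) = (u + transpose L *v ybar k, w - L *v xbar k)"
    by (simp only: P_op_def diff_Pair prod.case 1 2 4 5)
  then show ?thesis using u(1) w(1) by (auto simp: T_PD_def)
qed

text \<open>\<open>E\<close> decreases to a limit, so its increments vanish, and they dominate
  \<open>N\<close> as soon as \<open>c\<close> stays above a positive constant, which the
  \<open>liminf\<close> provides eventually.\<close>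

lemma tendsto_zero_if_summed_descent:
  fixes E N c :: "nat \<Rightarrow> real"
  assumes E: "\<And>k. 0 \<le> E k" and N: "\<And>k. 0 \<le> N k" and c: "\<And>k. 0 \<le> c k"
    and step: "\<And>k. E (Suc k) \<le> E k - c k * N k"
    and lim: "liminf (\<lambda>k. ereal (c k)) > 0"
  shows "decseq E" "N \<longlonglongrightarrow> 0"
proof -
  have "E (Suc k) \<le> E k" for k using step[of k] mult_nonneg_nonneg[OF c N, of k k] by linarith
  then show dec: "decseq E" by (rule decseq_SucI)
  obtain l where l: "E \<longlonglongrightarrow> l" using decseq_convergent[OF dec, of 0] E by blast
  obtain d where d: "0 < ereal d" "ereal d < liminf (\<lambda>k. ereal (c k))"
    using ereal_dense2[OF lim] by blast
  have ev: "\<forall>\<^sub>F k in sequentially. d < c k" using less_LiminfD[OF d(2)] by simp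
  have diff: "(\<lambda>k. (E k - E (Suc k)) / d) \<longlonglongrightarrow> (l - l) / d"
    using d(1) by (intro tendsto_intros l LIMSEQ_Suc) auto
  show "N \<longlonglongrightarrow> 0"
  proof (rule tendsto_sandwich[OF _ _ tendsto_const])
    show "\<forall>\<^sub>F k in sequentially. N k \<le> (E k - E (Suc k)) / d"
      using ev
    proof eventually_elim
      case (elim k)
      have "d * N k \<le> c k * N k" using elim N by (intro mult_right_mono) auto
      then have "N k * d \<le> E k - E (Suc k)" using step[of k] by (simp add: mult.commute)
      then show ?case using d(1) by (simp add: pos_le_divide_eq)
    qed
    show "(\<lambda>k. (E k - E (Suc k)) / d) \<longlonglongrightarrow> 0" using diff by simp
  qed (use N in auto)
qed

lemma tendsto_zero_if_perturbed_contraction: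
  fixes r d :: "nat \<Rightarrow> real"
  assumes q: "0 \<le> q" "q < 1" and r: "\<And>k. 0 \<le> r k"
    and step: "\<And>k. r (Suc k) \<le> q * r k + d k" and d: "d \<longlonglongrightarrow> 0"
  shows "r \<longlonglongrightarrow> 0"
proof (rule LIMSEQ_I)
  fix e :: real assume e: "0 < e"
  \<comment> \<open>The factor \<open>1 - q\<close> makes \<open>e / 2\<close> the fixed point of
    the perturbed contraction \<open>t \<mapsto> q * t + e / 2 * (1 - q)\<close>.\<close>
  have "0 < e / 2 * (1 - q)" using e q by simp
  then obtain N where N: "\<And>k. k \<ge> N \<Longrightarrow> norm (d k - 0) < e / 2 * (1 - q)" using LIMSEQ_D[OF d] by blast
  have bound: "r (N + j) \<le> q ^ j * r N + e / 2" for j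
  proof (induction j)
    case 0
    then show ?case using e by simp
  next
    case (Suc j)
    have "r (N + Suc j) \<le> q * r (N + j) + d (N + j)" using step[of "N + j"] by simp
    also have "\<dots> \<le> q * (q ^ j * r N + e / 2) + e / 2 * (1 - q)"
      using Suc q N[of "N + j"] by (intro add_mono mult_left_mono) auto
    also have "\<dots> = q ^ Suc j * r N + e / 2" by (simp add: field_simps)
    finally show ?case .
  qed
  have "(\<lambda>j. q ^ j * r N) \<longlonglongrightarrow> 0 * r N" using q by (intro tendsto_intros LIMSEQ_realpow_zero) auto
  then obtain M where M: "\<And>j. j \<ge> M \<Longrightarrow> norm (q ^ j * r N - 0 * r N) < e / 2"
    using LIMSEQ_D e by (metis half_gt_zero)
  show "\<exists>n0. \<forall>n\<ge>n0. norm (r n - 0) < e"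
  proof (intro exI allI impI)
    fix n assume "N + M \<le> n"
    then obtain j where "n = N + j" "M \<le> j" by (metis add.assoc add_leD1 le_iff_add nat_add_left_cancel_le)
    then show "norm (r n - 0) < e" using bound[of j] M[of j] r[of n] by auto
  qed
qed

text \<open>Although \<open>a\<close> or \<open>b\<close> may be negative, the completed square has
  the positive weight \<open>a + b\<close>; it bounds \<open>p\<close> up to a multiple of the
  bounded \<open>v\<close>.\<close>

lemma parallel_sum_coercive:
  fixes C D :: real
  assumes "a + b > 0"
  obtains K where "\<And>p v :: 'a::real_inner.
    a * (norm p)\<^sup>2 + b * (norm (v + p))\<^sup>2 \<le> C \<Longrightarrow> norm v \<le> D \<Longrightarrow> norm p \<le> K"
proof
  fix p v :: 'a
  assume le: "a * (norm p)\<^sup>2 + b * (norm (v + p))\<^sup>2 \<le> C" and v: "norm v \<le> D"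
  let ?t = "b / (a + b)"
  have "\<bar>a \<box> b\<bar> * (norm v)\<^sup>2 \<le> \<bar>a \<box> b\<bar> * D\<^sup>2" using v by (intro mult_left_mono power_mono) auto
  moreover have "- (\<bar>a \<box> b\<bar> * (norm v)\<^sup>2) \<le> (a \<box> b) * (norm v)\<^sup>2"
    using mult_right_mono[of "- \<bar>a \<box> b\<bar>" "a \<box> b" "(norm v)\<^sup>2"] by simp
  ultimately have "(a + b) * (norm (p + ?t *\<^sub>R v))\<^sup>2 \<le> C + \<bar>a \<box> b\<bar> * D\<^sup>2"
    using parallel_sum_norm_bound[of a b p v] assms le by simp
  then have "(norm (p + ?t *\<^sub>R v))\<^sup>2 \<le> (C + \<bar>a \<box> b\<bar> * D\<^sup>2) / (a + b)"
    using assms by (simp add: pos_le_divide_eq mult.commute)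
  then have 1: "norm (p + ?t *\<^sub>R v) \<le> sqrt ((C + \<bar>a \<box> b\<bar> * D\<^sup>2) / (a + b))" by (rule real_le_rsqrt)
  have "norm p \<le> norm (p + ?t *\<^sub>R v) + norm (?t *\<^sub>R v)"
    using norm_triangle_ineq4[of "p + ?t *\<^sub>R v" "?t *\<^sub>R v"] by simp
  moreover have "norm (?t *\<^sub>R v) \<le> \<bar>?t\<bar> * D" using v by (simp only: norm_scaleR mult_left_mono abs_ge_zero)
  ultimately show "norm p \<le> sqrt ((C + \<bar>a \<box> b\<bar> * D\<^sup>2) / (a + b)) + \<bar>b / (a + b)\<bar> * D"
    using 1 by linarith
qed

text \<open>What monotonicity at a single point gives for a resolvent: the displacement of the
  output is bounded by that of the input.\<close>

lemma norm_le_norm_add_scaleR: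
  fixes a b :: "'a::real_inner"
  assumes "0 \<le> a \<bullet> b" "0 \<le> c"
  shows "norm a \<le> norm (a + c *\<^sub>R b)"
proof (rule power2_le_imp_le)
  have "(norm (a + c *\<^sub>R b))\<^sup>2 = (norm a)\<^sup>2 + 2 * (c * (a \<bullet> b)) + c\<^sup>2 * (norm b)\<^sup>2"
    unfolding power2_norm_eq_inner by (simp add: inner_add inner_commute power2_eq_square)
  moreover have "0 \<le> c * (a \<bullet> b)" using assms by simp
  moreover have "0 \<le> c\<^sup>2 * (norm b)\<^sup>2" by simp
  ultimately show "(norm a)\<^sup>2 \<le> (norm (a + c *\<^sub>R b))\<^sup>2" by linarith
qed simp

lemma bounded_range_linear:
  fixes g :: "nat \<Rightarrow> 'a::real_normed_vector"
  assumes "bounded_linear f" "bounded (range g)"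
  shows "bounded (range (\<lambda>k. f (g k)))"
  using bounded_linear_image[OF assms(2,1)] by (simp add: image_image)

lemma bounded_range_dominated:
  assumes "bounded (range g)" "\<And>k. norm (f k) \<le> norm (g k)"
  shows "bounded (range f)"
  using assms unfolding bounded_iff by (metis (no_types, lifting) order_trans rangeE rangeI)

text \<open>Along the null space of \<open>P\<close> the two components determine each other, so a bound on \<open>L dx\<close>
  or on \<open>L\<^sup>T dy\<close>, together with a bound on \<open>P dz\<close>, bounds \<open>dz\<close>.\<close>

lemma T_PD_points_bounded:
  fixes L :: "real^'n^'m" and zbar w :: "nat \<Rightarrow> (real^'n) \<times> (real^'m)"
  assumes pos: "\<gamma> > 0" "\<tau> > 0"
    and A: "semimonotone_at (\<mu>A *\<^sub>R (transpose L ** L)) (\<rho>A *\<^sub>R mat 1) A xs (- (transpose L *v ys))"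
    and B: "semimonotone_at (\<mu>B *\<^sub>R mat 1) (\<rho>B *\<^sub>R (L ** transpose L)) B (L *v xs) ys"
    and mu: "\<mu>A + \<mu>B > 0 \<or> \<mu>A = 0 \<and> \<mu>B = 0"
    and rho: "\<rho>A + \<rho>B > 0 \<or> \<rho>A = 0 \<and> \<rho>B = 0"
    and T: "\<And>k. P_op L \<gamma> \<tau> (w k) \<in> T_PD L A B (zbar k)"
    and bdd: "bounded (range (\<lambda>k. P_op L \<gamma> \<tau> (w k)))" "bounded (range (\<lambda>k. P_op L \<gamma> \<tau> (zbar k)))"
  shows "bounded (range zbar)"
proof -
  let ?P = "P_op L \<gamma> \<tau>"
  define dx where "dx k = fst (zbar k) - xs" for k
  define dy where "dy k = snd (zbar k) - ys" for k
  define v1 where "v1 k = fst (?P (w k))" for k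
  define v2 where "v2 k = snd (?P (w k))" for k
  have dz: "(dx k, dy k) = zbar k - (xs, ys)" for k by (simp add: dx_def dy_def prod_eq_iff)
  have v: "?P (w k) = (v1 k, v2 k)" for k by (simp add: v1_def v2_def)
  have T': "(v1 k, v2 k) \<in> T_PD L A B (fst (zbar k), snd (zbar k))" for k
    using T[of k] by (simp add: v)
  note mono = T_PD_semimonotone[OF A B T', folded dx_def dy_def]
  define d1 where "d1 k = (1 / \<gamma>) *\<^sub>R dx k - transpose L *v dy k" for k
  define d2 where "d2 k = (1 / \<tau>) *\<^sub>R dy k - L *v dx k" for k
  have d: "?P (zbar k) - ?P (xs, ys) = (d1 k, d2 k)" for k
    unfolding linear_diff[OF linear_P_op, symmetric] dz[symmetric]
    by (simp add: P_op_def d1_def d2_def)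
  have bd: "bounded (range (\<lambda>k. (d1 k, d2 k)))"
    unfolding d[symmetric] by (intro bounded_minus_comp bdd) simp
  have b1: "bounded (range d1)" and b2: "bounded (range d2)"
    using bounded_range_linear[OF bounded_linear_fst bd] bounded_range_linear[OF bounded_linear_snd bd]
    by simp_all
  have bv1: "bounded (range v1)" and bv2: "bounded (range v2)"
    using bounded_range_linear[OF bounded_linear_fst bdd(1)] bounded_range_linear[OF bounded_linear_snd bdd(1)]
    by (simp_all add: v)
  have bL: "bounded (range (\<lambda>k. L *v g k))" if "bounded (range g)" for g :: "nat \<Rightarrow> real^'n"
    using bounded_range_linear[OF matrix_vector_mul_bounded_linear that] .
  have bLt: "bounded (range (\<lambda>k. transpose L *v g k))" if "bounded (range g)" for g :: "nat \<Rightarrow> real^'m"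
    using bounded_range_linear[OF matrix_vector_mul_bounded_linear that] .
  have dx_eq: "dx = (\<lambda>k. \<gamma> *\<^sub>R (d1 k + transpose L *v dy k))"
    and dy_eq: "dy = (\<lambda>k. \<tau> *\<^sub>R (d2 k + L *v dx k))"
    using pos by (auto simp: d1_def d2_def)
  have dx_if: "bounded (range dx)" if "bounded (range (\<lambda>k. transpose L *v dy k))"
    by (subst dx_eq) (intro bounded_scaleR_comp bounded_plus_comp b1 that)
  have dy_if: "bounded (range dy)" if "bounded (range (\<lambda>k. L *v dx k))"
    by (subst dy_eq) (intro bounded_scaleR_comp bounded_plus_comp b2 that)
  have "bounded (range dx) \<and> bounded (range dy)"
  proof (cases "\<mu>A + \<mu>B > 0 \<or> \<rho>A + \<rho>B > 0")
    case False
    then have z: "\<mu>A = 0" "\<mu>B = 0" "\<rho>A = 0" "\<rho>B = 0" using mu rho by auto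
    \<comment> \<open>By the definition of \<open>d1\<close>, the displacement of the resolvent
      argument is \<open>\<gamma> *\<^sub>R (d1 k + v1 k)\<close>, which is bounded although
      \<open>dy\<close> is not yet known to be.\<close>
    have "norm (dx k) \<le> norm (\<gamma> *\<^sub>R (d1 k + v1 k))" for k
    proof -
      have "norm (dx k) \<le> norm (dx k + \<gamma> *\<^sub>R (v1 k - transpose L *v dy k))"
        using mono(1)[of k] pos by (intro norm_le_norm_add_scaleR) (auto simp: z)
      also have "dx k + \<gamma> *\<^sub>R (v1 k - transpose L *v dy k) = \<gamma> *\<^sub>R (d1 k + v1 k)"
        using pos by (simp add: d1_def algebra_simps)
      finally show ?thesis .
    qed
    then have bx: "bounded (range dx)"
      by (rule bounded_range_dominated[rotated]) (intro bounded_scaleR_comp bounded_plus_comp b1 bv1)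
    then show ?thesis using dy_if[OF bL] by blast
  next
    case True
    obtain e where e: "e > 0"
      "\<And>z w. e * norm (proj_P L \<gamma> \<tau> z - proj_P L \<gamma> \<tau> w) \<le> norm (?P (z - w))"
      using closest_point_range_selfadjoint(3)[OF linear_P_op P_op_selfadjoint]
      unfolding proj_P_def by blast
    obtain C1 where C1: "\<And>k. norm (d1 k, d2 k) \<le> C1" using bd by (auto simp: bounded_iff)
    obtain C2 where C2: "\<And>k. norm (v1 k, v2 k) \<le> C2"
      using bdd(1) unfolding v by (auto simp: bounded_iff)
    have C2': "norm (v1 k) \<le> C2" "norm (v2 k) \<le> C2" for k
      using C2[of k] norm_fst_le[of "v1 k" "v2 k"] norm_snd_le[of "v2 k" "v1 k"] by linarith+
    define C where "C = (C1 / e) * C2"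
    \<comment> \<open>\<open>(v1 k, v2 k)\<close> lies in the range of \<open>P\<close>, so only the
      projection of \<open>(dx k, dy k)\<close> enters; that one is already bounded.\<close>
    have inner_le: "(dx k, dy k) \<bullet> (v1 k, v2 k) \<le> C" for k
    proof -
      let ?u = "proj_P L \<gamma> \<tau> (dx k, dy k)"
      have "0 = ?P 0" by (simp add: P_op_def zero_prod_def)
      then have "(0 :: (real^'n) \<times> (real^'m)) \<in> range ?P" by (metis rangeI)
      then have "proj_P L \<gamma> \<tau> 0 = 0" unfolding proj_P_def by (rule closest_point_self)
      then have "e * norm ?u \<le> norm (?P (dx k, dy k))" using e(2)[of "(dx k, dy k)" 0] by simp
      also have "?P (dx k, dy k) = (d1 k, d2 k)" by (simp add: P_op_def d1_def d2_def)
      also have "norm (d1 k, d2 k) \<le> C1" by (rule C1)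
      finally have u: "norm ?u \<le> C1 / e" using e(1) by (simp add: pos_le_divide_eq mult.commute)
      have "(dx k, dy k) \<bullet> (v1 k, v2 k) = ?u \<bullet> (v1 k, v2 k)"
        using closest_point_range_selfadjoint(2)[OF linear_P_op P_op_selfadjoint, of "(dx k, dy k)" L \<gamma> \<tau> "w k"]
        unfolding v proj_P_def by (simp only: inner_diff_left)
      also have "\<dots> \<le> norm ?u * norm (v1 k, v2 k)" by (rule norm_cauchy_schwarz)
      also have "\<dots> \<le> (C1 / e) * C2" using u C2[of k] by (intro mult_mono) (auto intro: order_trans[OF norm_ge_zero])
      finally show ?thesis by (simp add: C_def)
    qed
    \<comment> \<open>Each pair of terms is bounded below through its parallel sum, so the upper
      bound on the total bounds the other pair from above.\<close>
    have lowA: "- (\<bar>\<mu>A \<box> \<mu>B\<bar> * C2\<^sup>2) \<le> \<mu>A * (norm (L *v dx k))\<^sup>2 + \<mu>B * (norm (v2 k + L *v dx k))\<^sup>2" for k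
    proof -
      have "\<bar>\<mu>A \<box> \<mu>B\<bar> * (norm (v2 k))\<^sup>2 \<le> \<bar>\<mu>A \<box> \<mu>B\<bar> * C2\<^sup>2"
        using C2'[of k] by (intro mult_left_mono power_mono) auto
      moreover have "- \<bar>\<mu>A \<box> \<mu>B\<bar> * (norm (v2 k))\<^sup>2 \<le> (\<mu>A \<box> \<mu>B) * (norm (v2 k))\<^sup>2"
        by (intro mult_right_mono) auto
      ultimately show ?thesis using parallel_sum_norm_le[OF mu, of "v2 k" "L *v dx k"] by simp
    qed
    have rho': "\<rho>B + \<rho>A > 0 \<or> \<rho>B = 0 \<and> \<rho>A = 0" using rho by (auto simp: add.commute)
    have lowB: "- (\<bar>\<rho>B \<box> \<rho>A\<bar> * C2\<^sup>2)
      \<le> \<rho>B * (norm (- (transpose L *v dy k)))\<^sup>2 + \<rho>A * (norm (v1 k + - (transpose L *v dy k)))\<^sup>2" for k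
    proof -
      have "\<bar>\<rho>B \<box> \<rho>A\<bar> * (norm (v1 k))\<^sup>2 \<le> \<bar>\<rho>B \<box> \<rho>A\<bar> * C2\<^sup>2"
        using C2'[of k] by (intro mult_left_mono power_mono) auto
      moreover have "- \<bar>\<rho>B \<box> \<rho>A\<bar> * (norm (v1 k))\<^sup>2 \<le> (\<rho>B \<box> \<rho>A) * (norm (v1 k))\<^sup>2"
        by (intro mult_right_mono) auto
      ultimately show ?thesis using parallel_sum_norm_le[OF rho', of "v1 k" "- (transpose L *v dy k)"] by simp
    qed
    have total: "\<mu>A * (norm (L *v dx k))\<^sup>2 + \<mu>B * (norm (v2 k + L *v dx k))\<^sup>2
      + (\<rho>B * (norm (- (transpose L *v dy k)))\<^sup>2 + \<rho>A * (norm (v1 k + - (transpose L *v dy k)))\<^sup>2) \<le> C" for k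
      using mono(3)[of k] inner_le[of k] by simp
    from True show ?thesis
    proof
      assume "\<mu>A + \<mu>B > 0"
      then obtain K where K: "\<And>p v :: real^'m. \<mu>A * (norm p)\<^sup>2 + \<mu>B * (norm (v + p))\<^sup>2
          \<le> C + \<bar>\<rho>B \<box> \<rho>A\<bar> * C2\<^sup>2 \<Longrightarrow> norm v \<le> C2 \<Longrightarrow> norm p \<le> K"
        using parallel_sum_coercive by blast
      have "norm (L *v dx k) \<le> K" for k
        using K[of "L *v dx k" "v2 k"] total[of k] lowB[of k] C2'[of k] by linarith
      then have "bounded (range (\<lambda>k. L *v dx k))" by (auto simp: bounded_iff)
      from dy_if[OF this] show ?thesis using dx_if[OF bLt] by blast
    next
      assume "\<rho>A + \<rho>B > 0"
      then have "\<rho>B + \<rho>A > 0" by simp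
      then obtain K where K: "\<And>p v :: real^'n. \<rho>B * (norm p)\<^sup>2 + \<rho>A * (norm (v + p))\<^sup>2
          \<le> C + \<bar>\<mu>A \<box> \<mu>B\<bar> * C2\<^sup>2 \<Longrightarrow> norm v \<le> C2 \<Longrightarrow> norm p \<le> K"
        using parallel_sum_coercive by blast
      have "norm (- (transpose L *v dy k)) \<le> K" for k
        using K[of "- (transpose L *v dy k)" "v1 k"] total[of k] lowA[of k] C2'[of k] by linarith
      then have "bounded (range (\<lambda>k. transpose L *v dy k))" by (auto simp: bounded_iff)
      from dx_if[OF this] show ?thesis using dy_if[OF bL] by blast
    qed
  qed
  then have "bounded (range dx \<times> range dy)" by (simp add: bounded_Times)
  then have "bounded (range (\<lambda>k. (dx k, dy k)))" by (rule bounded_subset) auto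
  then have "bounded (range (\<lambda>k. (xs, ys) + (dx k, dy k)))" by (intro bounded_plus_comp) auto
  moreover have "(xs, ys) + (dx k, dy k) = zbar k" for k unfolding dz by simp
  ultimately show ?thesis by simp
qed

theorem corollary5p6:
  fixes L :: "real^'n^'m"
    and A :: "real^'n \<Rightarrow> (real^'n) set"
    and B :: "real^'m \<Rightarrow> (real^'m) set"
    and \<gamma> \<tau> \<mu>A \<mu>B \<rho>A \<rho>B \<beta>P \<beta>D \<eta> :: real
    and S :: "((real^'n) \<times> (real^'m)) set"
    and lam :: "nat \<Rightarrow> real"
    and x xbar :: "nat \<Rightarrow> real^'n"
    and y ybar :: "nat \<Rightarrow> real^'m"
    and z zbar :: "nat \<Rightarrow> (real^'n) \<times> (real^'m)"
  assumes "L \<noteq> 0"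
    and "outer_semicontinuous A" and "outer_semicontinuous B"
    and "\<gamma> > 0" and "\<tau> > 0"
    and "dom_op (resolvent (scale_op \<gamma> A)) = UNIV"
    and "dom_op (resolvent (scale_op \<tau> (inv_op B))) = UNIV"
    and "zer (T_PD L A B) \<noteq> {}"
    and "S \<noteq> {}" and "S \<subseteq> zer (T_PD L A B)"
    and "\<And>xs ys. (xs, ys) \<in> S \<Longrightarrow>
           semimonotone_at (\<mu>A *\<^sub>R (transpose L ** L)) (\<rho>A *\<^sub>R mat 1) A xs (- (transpose L *v ys))"
    and "\<And>xs ys. (xs, ys) \<in> S \<Longrightarrow>
           semimonotone_at (\<mu>B *\<^sub>R mat 1) (\<rho>B *\<^sub>R (L ** transpose L)) B (L *v xs) ys"
    and "(\<mu>A = 0 \<and> \<mu>B = 0 \<and> \<rho>A = 0 \<and> \<rho>B = 0) \<or>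
         (\<mu>A + \<mu>B > 0 \<and> \<rho>A = 0 \<and> \<rho>B = 0) \<or>
         (\<rho>A + \<rho>B > 0 \<and> \<mu>A = 0 \<and> \<mu>B = 0) \<or>
         (\<mu>A + \<mu>B > 0 \<and> \<rho>A + \<rho>B > 0 \<and>
          neg_part (\<mu>A \<box> \<mu>B) * neg_part (\<rho>A \<box> \<rho>B) < 1 / (4 * (opnorm L)\<^sup>2))"
    and "\<beta>P = \<rho>A \<box> \<rho>B" and "\<beta>D = \<mu>A \<box> \<mu>B"
    and "stepsize_rule L \<beta>P \<beta>D \<gamma> \<tau>"
    and "\<eta> = eta_bar L \<mu>A \<mu>B \<rho>A \<rho>B \<gamma> \<tau>"
    and "\<And>k. lam k \<in> {0<..<2 * (1 + \<eta>)}"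
    and "liminf (\<lambda>k. ereal (lam k * (2 * (1 + \<eta>) - lam k))) > 0"
    and "CPA L A B \<gamma> \<tau> lam x y xbar ybar"
    and "\<And>k. z k = (x k, y k)" and "\<And>k. zbar k = (xbar k, ybar k)"
  shows "(\<exists>k. zbar k \<in> zer (T_PD L A B)) \<or>
    ((\<forall>k. P_op L \<gamma> \<tau> (z k - zbar k) \<in> T_PD L A B (zbar k)) \<and>
     (\<lambda>k. P_op L \<gamma> \<tau> (z k - zbar k)) \<longlonglongrightarrow> 0 \<and>

     (\<forall>w. seq_limit_point zbar w \<longrightarrow> w \<in> zer (T_PD L A B)) \<and>

     bounded (range (\<lambda>k. proj_P L \<gamma> \<tau> (z k))) \<and>
     bounded (range (\<lambda>k. proj_P L \<gamma> \<tau> (zbar k))) \<and>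
     (\<forall>w. seq_limit_point (\<lambda>k. proj_P L \<gamma> \<tau> (z k)) w \<longrightarrow>
          w \<in> proj_P L \<gamma> \<tau> ` zer (T_PD L A B)) \<and>
     (\<forall>w. seq_limit_point (\<lambda>k. proj_P L \<gamma> \<tau> (zbar k)) w \<longrightarrow>
          w \<in> proj_P L \<gamma> \<tau> ` zer (T_PD L A B)) \<and>

     (proj_P L \<gamma> \<tau> ` S = proj_P L \<gamma> \<tau> ` zer (T_PD L A B) \<longrightarrow>
        (\<exists>w \<in> proj_P L \<gamma> \<tau> ` zer (T_PD L A B).
           (\<lambda>k. proj_P L \<gamma> \<tau> (z k)) \<longlonglongrightarrow> w \<and>
           (\<lambda>k. proj_P L \<gamma> \<tau> (zbar k)) \<longlonglongrightarrow> w) \<and>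
        (single_valued_continuous (resolvent (scale_op \<gamma> A)) \<and>
         single_valued_continuous (resolvent (scale_op \<tau> (inv_op B))) \<longrightarrow>
           (\<exists>zs \<in> zer (T_PD L A B).
              zbar \<longlonglongrightarrow> zs \<and>
              ((\<exists>a b. 0 < a \<and> b < 2 \<and> (\<forall>k. lam k \<in> {a..b})) \<longrightarrow> z \<longlonglongrightarrow> zs)))))"
proof (rule disjI2)
  note L = assms(1) and oscA = assms(2) and oscB = assms(3) and pos = assms(4,5)
  note semiA = assms(11) and semiB = assms(12) and cpa = assms(20)
  let ?P = "P_op L \<gamma> \<tau>" and ?c = "proj_P L \<gamma> \<tau>" and ?Z = "zer (T_PD L A B)"
  have mu: "\<mu>A + \<mu>B > 0 \<or> \<mu>A = 0 \<and> \<mu>B = 0" and rho: "\<rho>A + \<rho>B > 0 \<or> \<rho>A = 0 \<and> \<rho>B = 0"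
    using assms(13) by auto
  have op: "opnorm L > 0" using opnorm_pos[OF L] .
  have "\<tau> \<le> 1 / (\<gamma> * (opnorm L)\<^sup>2)"
    using assms(16) unfolding stepsize_rule_def
    by (cases "\<beta>P \<ge> 0"; cases "\<beta>D \<ge> 0") auto
  then have gt: "\<gamma> * \<tau> \<le> 1 / (opnorm L)\<^sup>2" and op2: "(opnorm L)\<^sup>2 \<le> (1 / \<gamma>) * (1 / \<tau>)"
    using pos op by (simp_all add: field_simps)
  have z: "z k = (x k, y k)" and zbar: "zbar k = (xbar k, ybar k)" for k using assms(21,22) by auto
  define w where "w k = z k - zbar k" for k
  have T: "?P (w k) \<in> T_PD L A B (zbar k)" for k
    unfolding w_def z zbar by (rule CPA_step_in_T_PD[OF cpa pos])
  have zSuc: "z (Suc k) = z k - lam k *\<^sub>R w k" for k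
    using cpa by (simp add: z zbar w_def CPA_def scaleR_diff_right)
  have lam: "0 < lam k" "lam k < 2 * (1 + \<eta>)" for k using assms(18)[of k] by auto
  note lin = linear_P_op[of L \<gamma> \<tau>] and sym = P_op_selfadjoint[of L \<gamma> \<tau>]
  have psd: "0 \<le> u \<bullet> ?P u" for u by (rule P_op_psd[OF pos op2])
  obtain K where K: "K > 0" "\<And>u. (norm (?P u))\<^sup>2 \<le> K * (u \<bullet> ?P u)"
    using selfadjoint_psd_norm_le[OF lin sym psd] by blast
  have bl: "bounded_linear ?P" using lin by (simp add: linear_conv_bounded_linear)
  note proj = closest_point_range_selfadjoint[OF lin sym, folded proj_P_def]
  obtain e where e: "e > 0" "\<And>u v. e * norm (?c u - ?c v) \<le> norm (?P (u - v))"
    using proj(3) by blast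
  have range_sub: "subspace (range ?P)" using lin by (simp add: linear_subspace_image)
  have c_cont: "continuous (at u) ?c" for u
    unfolding proj_P_def
    by (intro continuous_at_closest_point subspace_imp_convex closed_subspace range_sub) auto

  \<comment> \<open>Fejer descent in the seminorm of P\<close>
  define E where "E zs k = (z k - zs) \<bullet> ?P (z k - zs)" for zs k
  define N where "N k = w k \<bullet> ?P (w k)" for k
  have descent: "E zs (Suc k) \<le> E zs k - lam k * (2 * (1 + \<eta>) - lam k) * N k" if zs: "zs \<in> S" for zs k
  proof -
    obtain xs ys where s: "zs = (xs, ys)" by (cases zs)
    obtain v1 v2 where v: "?P (w k) = (v1, v2)" by (cases "?P (w k)")
    have "\<eta> * N k \<le> (zbar k - zs) \<bullet> ?P (w k)"
      using order_trans[OF eta_bar_form_le[OF L pos gt mu rho v]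
          T_PD_semimonotone(3)[OF semiA semiB, of xs ys v1 v2 "xbar k" "ybar k"]]
        T[of k] zs by (simp add: s zbar v N_def assms(17))
    \<comment> \<open>Passing from \<open>zbar k\<close> to \<open>z k\<close> adds one copy of
      \<open>N k\<close>; this turns \<open>\<eta>\<close> into \<open>1 + \<eta>\<close> and
      explains the relaxation range up to \<open>2 * (1 + \<eta>)\<close>.\<close>
    moreover have "(z k - zs) \<bullet> ?P (w k) = N k + (zbar k - zs) \<bullet> ?P (w k)"
      by (simp add: N_def w_def inner_diff_left)
    ultimately have le: "(1 + \<eta>) * N k \<le> (z k - zs) \<bullet> ?P (w k)" by (simp add: distrib_right)
    have expand: "(u - t *\<^sub>R v) \<bullet> ?P (u - t *\<^sub>R v)
        = u \<bullet> ?P u - 2 * t * (u \<bullet> ?P v) + t\<^sup>2 * (v \<bullet> ?P v)" for u v t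
      using sym[of u v] unfolding linear_diff[OF lin] linear_cmul[OF lin]
      by (simp add: inner_diff inner_commute power2_eq_square algebra_simps)
    have "z (Suc k) - zs = (z k - zs) - lam k *\<^sub>R w k" by (simp add: zSuc)
    then have "E zs (Suc k) = ((z k - zs) - lam k *\<^sub>R w k) \<bullet> ?P ((z k - zs) - lam k *\<^sub>R w k)"
      by (simp only: E_def)
    also have "\<dots> = E zs k - 2 * lam k * ((z k - zs) \<bullet> ?P (w k)) + (lam k)\<^sup>2 * N k"
      unfolding expand E_def N_def ..
    also have "\<dots> \<le> E zs k - 2 * lam k * ((1 + \<eta>) * N k) + (lam k)\<^sup>2 * N k"
      using le lam[of k] by (intro add_right_mono diff_left_mono mult_left_mono) auto
    finally show ?thesis by (simp add: power2_eq_square algebra_simps)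
  qed
  have E_nonneg: "0 \<le> E zs k" for zs k by (simp add: E_def psd)
  have N_nonneg: "0 \<le> N k" for k by (simp add: N_def psd)
  have c_nonneg: "0 \<le> lam k * (2 * (1 + \<eta>) - lam k)" for k using lam[of k] by simp
  note fejer = tendsto_zero_if_summed_descent[OF E_nonneg N_nonneg c_nonneg descent assms(19)]

  \<comment> \<open>Vanishing residual and boundedness\<close>
  obtain zs where zs: "zs \<in> S" using assms(9) by blast
  obtain xs ys where xys: "zs = (xs, ys)" by (cases zs)
  have lim_if: "(\<lambda>k. ?P (u k)) \<longlonglongrightarrow> 0" if "(\<lambda>k. u k \<bullet> ?P (u k)) \<longlonglongrightarrow> 0" for u :: "nat \<Rightarrow> _"
  proof -
    have "(\<lambda>k. (norm (?P (u k)))\<^sup>2) \<longlonglongrightarrow> 0"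
    proof (rule tendsto_sandwich[OF _ _ tendsto_const])
      show "(\<lambda>k. K * (u k \<bullet> ?P (u k))) \<longlonglongrightarrow> 0" using tendsto_mult_right_zero[OF that] by simp
    qed (use K in auto)
    then have "(\<lambda>k. sqrt ((norm (?P (u k)))\<^sup>2)) \<longlonglongrightarrow> sqrt 0" by (rule tendsto_real_sqrt)
    then show ?thesis by (simp add: tendsto_norm_zero_iff)
  qed
  have Pw0: "(\<lambda>k. ?P (w k)) \<longlonglongrightarrow> 0"
    using fejer(2)[OF zs] unfolding N_def by (rule lim_if)
  have bPw: "bounded (range (\<lambda>k. ?P (w k)))" using convergent_imp_bounded[OF Pw0] .
  have Pz_le: "norm (?P (z k - zs)) \<le> sqrt (K * E zs 0)" for k
  proof -
    have "E zs k \<le> E zs 0" using fejer(1)[OF zs] by (simp add: decseqD)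
    then have "K * E zs k \<le> K * E zs 0" using K(1) by simp
    with K(2)[of "z k - zs"] show ?thesis by (intro real_le_rsqrt) (simp add: E_def)
  qed
  then have "bounded (range (\<lambda>k. ?P (z k - zs)))" by (auto simp: bounded_iff)
  then have bPz: "bounded (range (\<lambda>k. ?P (z k)))"
    using bounded_plus_comp[of "\<lambda>k. ?P (z k - zs)" UNIV "\<lambda>k. ?P zs"]
    by (simp add: linear_diff[OF lin])
  have bPzbar: "bounded (range (\<lambda>k. ?P (zbar k)))"
    using bounded_minus_comp[OF bPz bPw] by (simp add: w_def linear_diff[OF lin])
  have bzbar: "bounded (range zbar)"
    using T_PD_points_bounded[OF pos semiA semiB mu rho T bPw bPzbar] zs xys by blast

  \<comment> \<open>Limit points\<close>
  have zer: "l \<in> ?Z" if r: "strict_mono r" and l: "(zbar \<circ> r) \<longlonglongrightarrow> l" for r l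
  proof -
    have "0 \<in> T_PD L A B l"
      by (rule T_PD_closed[OF oscA oscB, of "\<lambda>k. ?P (w (r k))" L "zbar \<circ> r"])
        (use T l LIMSEQ_subseq_LIMSEQ[OF Pw0 r] in \<open>auto simp: o_def\<close>)
    then show ?thesis by (simp add: zer_def)
  qed
  have c_lim_if: "(\<lambda>k. ?c (u k) - ?c (v k)) \<longlonglongrightarrow> 0" if "(\<lambda>k. ?P (u k - v k)) \<longlonglongrightarrow> 0"
    for u v :: "nat \<Rightarrow> _"
  proof (rule Lim_null_comparison)
    show "\<forall>\<^sub>F k in sequentially. norm (?c (u k) - ?c (v k)) \<le> norm (?P (u k - v k)) / e"
      using e by (simp add: pos_le_divide_eq mult.commute)
    show "(\<lambda>k. norm (?P (u k - v k)) / e) \<longlonglongrightarrow> 0"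
      using tendsto_divide[OF tendsto_norm_zero[OF that] tendsto_const[of e]] e(1) by simp
  qed
  have c_diff: "(\<lambda>k. ?c (z k) - ?c (zbar k)) \<longlonglongrightarrow> 0"
    using c_lim_if[of z zbar] Pw0 by (simp add: w_def)
  have bcz: "bounded (range (\<lambda>k. ?c (z k)))"
  proof -
    have "norm (?c (z k) - ?c zs) \<le> sqrt (K * E zs 0) / e" for k
      using order_trans[OF e(2) Pz_le, of k] e(1) by (simp add: pos_le_divide_eq mult.commute)
    then have "bounded (range (\<lambda>k. ?c (z k) - ?c zs))" by (auto simp: bounded_iff)
    then show ?thesis using bounded_plus_comp[of "\<lambda>k. ?c (z k) - ?c zs" UNIV "\<lambda>k. ?c zs"] by simp
  qed
  have bczbar: "bounded (range (\<lambda>k. ?c (zbar k)))"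
    using bounded_minus_comp[OF bcz convergent_imp_bounded[OF c_diff]] by simp
  have czbar_lim: "l \<in> ?c ` ?Z" if "seq_limit_point (\<lambda>k. ?c (zbar k)) l" for l
  proof -
    from that obtain r where r: "strict_mono r" and l: "(\<lambda>k. ?c (zbar (r k))) \<longlonglongrightarrow> l"
      by (auto simp: seq_limit_point_def o_def)
    \<comment> \<open>The projections converge along \<open>r\<close>, but a zero lying above their
      limit comes only from a further subsequence of the bounded \<open>zbar\<close>.\<close>
    have "bounded (range (zbar \<circ> r))" using bzbar by (rule bounded_subset) auto
    then obtain r' l' where r': "strict_mono r'" and l': "((zbar \<circ> r) \<circ> r') \<longlonglongrightarrow> l'"
      using bounded_imp_convergent_subsequence by blast
    have "l' \<in> ?Z" using zer[of "r \<circ> r'" l'] strict_mono_o[OF r r'] l' by (simp add: o_assoc)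
    moreover have "(\<lambda>k. ?c (zbar (r (r' k)))) \<longlonglongrightarrow> ?c l'"
      using isCont_tendsto_compose[OF c_cont l'] by (simp add: o_def)
    moreover have "(\<lambda>k. ?c (zbar (r (r' k)))) \<longlonglongrightarrow> l"
      using LIMSEQ_subseq_LIMSEQ[OF l r'] by (simp add: o_def)
    ultimately show ?thesis using LIMSEQ_unique by blast
  qed
  have cz_lim: "l \<in> ?c ` ?Z" if "seq_limit_point (\<lambda>k. ?c (z k)) l" for l
  proof (rule czbar_lim)
    from that obtain r where r: "strict_mono r" and l: "(\<lambda>k. ?c (z (r k))) \<longlonglongrightarrow> l"
      by (auto simp: seq_limit_point_def o_def)
    have "(\<lambda>k. ?c (z (r k)) - ?c (zbar (r k))) \<longlonglongrightarrow> 0"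
      using LIMSEQ_subseq_LIMSEQ[OF c_diff r] by (simp add: o_def)
    from tendsto_diff[OF l this] show "seq_limit_point (\<lambda>k. ?c (zbar k)) l"
      using r by (auto simp: seq_limit_point_def o_def)
  qed

  \<comment> \<open>Convergence of the whole sequences\<close>
  have part4: "(\<exists>l\<in>?c ` ?Z. (\<lambda>k. ?c (z k)) \<longlonglongrightarrow> l \<and> (\<lambda>k. ?c (zbar k)) \<longlonglongrightarrow> l) \<and>
        (single_valued_continuous (resolvent (scale_op \<gamma> A)) \<and>
         single_valued_continuous (resolvent (scale_op \<tau> (inv_op B))) \<longrightarrow>
           (\<exists>zs\<in>?Z. zbar \<longlonglongrightarrow> zs \<and>
              ((\<exists>a b. 0 < a \<and> b < 2 \<and> (\<forall>k. lam k \<in> {a..b})) \<longrightarrow> z \<longlonglongrightarrow> zs)))"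
    if eq: "?c ` S = ?c ` ?Z"
  proof -
    obtain r l where r: "strict_mono r" and l: "((\<lambda>k. ?c (z k)) \<circ> r) \<longlonglongrightarrow> l"
      using bounded_imp_convergent_subsequence[OF bcz] by blast
    have "l \<in> ?c ` ?Z" using cz_lim r l unfolding seq_limit_point_def by blast
    \<comment> \<open>The equality of projections enters here: the limit has a preimage in
      \<open>S\<close>, where descent is available.\<close>
    then obtain zt where zt: "zt \<in> S" "?c zt = l" unfolding eq[symmetric] by blast
    have Pc: "?P (z k - zt) = ?P (?c (z k)) - ?P l" for k
      using proj(1) zt(2) by (simp add: linear_diff[OF lin] flip: zt(2))
    have c0: "?c 0 = 0" unfolding proj_P_def using subspace_0[OF range_sub] by (rule closest_point_self)
    \<comment> \<open>The form is dominated by the squared norm of its image under \<open>P\<close>,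
      so \<open>E zt\<close> vanishes along \<open>r\<close>; being monotone, it then vanishes along
      the whole sequence.\<close>
    have E_le: "E zt k \<le> (norm (?P (z k - zt)))\<^sup>2 / e" for k
    proof -
      let ?u = "z k - zt"
      have "E zt k = ?c ?u \<bullet> ?P ?u" using proj(2)[of ?u ?u] by (simp add: E_def inner_diff_left)
      also have "\<dots> \<le> norm (?c ?u) * norm (?P ?u)" by (rule norm_cauchy_schwarz)
      also have "\<dots> \<le> (norm (?P ?u) / e) * norm (?P ?u)"
        using e(2)[of ?u 0] e(1) by (intro mult_right_mono) (auto simp: c0 pos_le_divide_eq mult.commute)
      finally show ?thesis by (simp add: power2_eq_square)
    qed
    have dec: "decseq (E zt)" using fejer(1)[OF zt(1)] .
    obtain E' where E': "E zt \<longlonglongrightarrow> E'" using decseq_convergent[OF dec] E_nonneg[of zt] by metis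
    have "(\<lambda>k. ?P (z (r k) - zt)) \<longlonglongrightarrow> ?P l - ?P l"
      unfolding Pc using l by (intro tendsto_diff bounded_linear.tendsto[OF bl]) (auto simp: o_def)
    then have "(\<lambda>k. (norm (?P (z (r k) - zt)))\<^sup>2 / e) \<longlonglongrightarrow> (norm (?P l - ?P l))\<^sup>2 / e"
      using e(1) by (intro tendsto_intros) auto
    then have bound0: "(\<lambda>k. (norm (?P (z (r k) - zt)))\<^sup>2 / e) \<longlonglongrightarrow> 0" by simp
    have "(\<lambda>k. E zt (r k)) \<longlonglongrightarrow> 0"
      by (rule tendsto_sandwich[OF _ _ tendsto_const bound0])
        (intro always_eventually allI E_nonneg E_le)+
    moreover have "(\<lambda>k. E zt (r k)) \<longlonglongrightarrow> E'" using LIMSEQ_subseq_LIMSEQ[OF E' r] by (simp add: o_def)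
    ultimately have "E' = 0" using LIMSEQ_unique by blast
    then have Pz0: "(\<lambda>k. ?P (z k - zt)) \<longlonglongrightarrow> 0" using E' unfolding E_def by (intro lim_if) simp
    have czl: "(\<lambda>k. ?c (z k)) \<longlonglongrightarrow> l"
      using c_lim_if[of z "\<lambda>_. zt"] Pz0 LIM_zero_iff[of "\<lambda>k. ?c (z k)" l] by (simp add: zt(2))
    have czbarl: "(\<lambda>k. ?c (zbar k)) \<longlonglongrightarrow> l" using tendsto_diff[OF czl c_diff] by simp
    have Pzl: "(\<lambda>k. ?P (z k)) \<longlonglongrightarrow> ?P zt"
      using Pz0 LIM_zero_iff[of "\<lambda>k. ?P (z k)" "?P zt"] by (simp add: linear_diff[OF lin])
    have last: "\<exists>zs\<in>?Z. zbar \<longlonglongrightarrow> zs \<and>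
              ((\<exists>a b. 0 < a \<and> b < 2 \<and> (\<forall>k. lam k \<in> {a..b})) \<longrightarrow> z \<longlonglongrightarrow> zs)"
      if sv: "single_valued_continuous (resolvent (scale_op \<gamma> A))"
        "single_valued_continuous (resolvent (scale_op \<tau> (inv_op B)))"
    proof -
      obtain f where f: "continuous_on UNIV f" "\<And>u. resolvent (scale_op \<gamma> A) u = {f u}"
        using sv(1) unfolding single_valued_continuous_def by blast
      obtain g where g: "continuous_on UNIV g" "\<And>u. resolvent (scale_op \<tau> (inv_op B)) u = {g u}"
        using sv(2) unfolding single_valued_continuous_def by blast
      have fc: "isCont f u" and gc: "isCont g v" for u v
        using f(1) g(1) by (simp_all add: continuous_on_eq_continuous_at)
      \<comment> \<open>\<open>xbar k\<close> depends on \<open>z k\<close> only through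
        \<open>P\<close> applied to it, and those images converge although \<open>z\<close> itself
        need not. The same holds for \<open>ybar k\<close> once \<open>xbar k\<close> is
        given.\<close>
      have xb: "xbar k = f (\<gamma> *\<^sub>R fst (?P (z k)))" for k
      proof -
        have "xbar k = f (x k - \<gamma> *\<^sub>R (transpose L *v y k))" using cpa f(2) by (simp add: CPA_def)
        then show ?thesis using pos by (simp add: z P_op_def scaleR_diff_right)
      qed
      have yb: "ybar k = g (\<tau> *\<^sub>R snd (?P (z k)) + (2 * \<tau>) *\<^sub>R (L *v xbar k))" for k
      proof -
        have "ybar k = g (y k + \<tau> *\<^sub>R (L *v (2 *\<^sub>R xbar k - x k)))" using cpa g(2) by (simp add: CPA_def)
        then show ?thesis using pos
          by (simp add: z P_op_def matrix_vector_mult_diff_distrib matrix_vector_mult_scaleR algebra_simps)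
      qed
      obtain lx where lx: "xbar \<longlonglongrightarrow> lx"
      proof
        show "xbar \<longlonglongrightarrow> f (\<gamma> *\<^sub>R fst (?P zt))"
          unfolding xb[abs_def] by (rule isCont_tendsto_compose[OF fc]) (intro tendsto_intros Pzl)
      qed
      obtain ly where ly: "ybar \<longlonglongrightarrow> ly"
      proof
        show "ybar \<longlonglongrightarrow> g (\<tau> *\<^sub>R snd (?P zt) + (2 * \<tau>) *\<^sub>R (L *v lx))"
          unfolding yb[abs_def]
          by (rule isCont_tendsto_compose[OF gc])
            (intro tendsto_intros Pzl lx bounded_linear.tendsto[OF matrix_vector_mul_bounded_linear])
      qed
      define lz where "lz = (lx, ly)"
      have lz: "zbar \<longlonglongrightarrow> lz" unfolding zbar[abs_def] lz_def by (intro tendsto_Pair lx ly)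
      have "lz \<in> ?Z" using zer[of id lz] lz by (simp add: strict_mono_id)
      moreover have "z \<longlonglongrightarrow> lz" if ab: "0 < a" "b < 2" "\<And>k. lam k \<in> {a..b}" for a b
      proof -
        \<comment> \<open>\<open>|1 - t|\<close> is convex in \<open>t\<close>, so on
          \<open>{a..b}\<close> it is largest at an endpoint, and both endpoints lie strictly
          between 0 and 2.\<close>
        define q where "q = max \<bar>1 - a\<bar> \<bar>1 - b\<bar>"
        have ab': "a \<le> b" using ab(3)[of 0] by simp
        have q: "0 \<le> q" "q < 1" using ab(1,2) ab' by (auto simp: q_def)
        have "(\<lambda>k. norm (z k - lz)) \<longlonglongrightarrow> 0"
        proof (rule tendsto_zero_if_perturbed_contraction[OF q])
          fix k
          have lk: "a \<le> lam k" "lam k \<le> b" using ab(3)[of k] by auto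
          then have lk': "\<bar>1 - lam k\<bar> \<le> q" "\<bar>lam k\<bar> \<le> 2" using ab(1,2) unfolding q_def by linarith+
          have "z (Suc k) - lz = (1 - lam k) *\<^sub>R (z k - lz) + lam k *\<^sub>R (zbar k - lz)"
            unfolding zSuc w_def by (simp add: algebra_simps)
          then have "norm (z (Suc k) - lz) \<le> \<bar>1 - lam k\<bar> * norm (z k - lz) + \<bar>lam k\<bar> * norm (zbar k - lz)"
            using norm_triangle_ineq[of "(1 - lam k) *\<^sub>R (z k - lz)" "lam k *\<^sub>R (zbar k - lz)"] by simp
          also have "\<dots> \<le> q * norm (z k - lz) + 2 * norm (zbar k - lz)"
            using lk' by (intro add_mono mult_right_mono) auto
          finally show "norm (z (Suc k) - lz) \<le> q * norm (z k - lz) + 2 * norm (zbar k - lz)" .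
        next
          show "(\<lambda>k. 2 * norm (zbar k - lz)) \<longlonglongrightarrow> 0"
            using lz by (intro tendsto_mult_right_zero tendsto_norm_zero) (simp add: LIM_zero_iff)
        qed simp
        then show ?thesis by (simp add: tendsto_norm_zero_iff LIM_zero_iff)
      qed
      ultimately show ?thesis using lz by blast
    qed
    show ?thesis using \<open>l \<in> ?c ` ?Z\<close> czl czbarl last by blast
  qed
  show "(\<forall>k. ?P (z k - zbar k) \<in> T_PD L A B (zbar k)) \<and>
     (\<lambda>k. ?P (z k - zbar k)) \<longlonglongrightarrow> 0 \<and>
     (\<forall>w. seq_limit_point zbar w \<longrightarrow> w \<in> ?Z) \<and>
     bounded (range (\<lambda>k. ?c (z k))) \<and> bounded (range (\<lambda>k. ?c (zbar k))) \<and>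
     (\<forall>w. seq_limit_point (\<lambda>k. ?c (z k)) w \<longrightarrow> w \<in> ?c ` ?Z) \<and>
     (\<forall>w. seq_limit_point (\<lambda>k. ?c (zbar k)) w \<longrightarrow> w \<in> ?c ` ?Z) \<and>
     (?c ` S = ?c ` ?Z \<longrightarrow>
        (\<exists>l\<in>?c ` ?Z. (\<lambda>k. ?c (z k)) \<longlonglongrightarrow> l \<and> (\<lambda>k. ?c (zbar k)) \<longlonglongrightarrow> l) \<and>
        (single_valued_continuous (resolvent (scale_op \<gamma> A)) \<and>
         single_valued_continuous (resolvent (scale_op \<tau> (inv_op B))) \<longrightarrow>
           (\<exists>zs\<in>?Z. zbar \<longlonglongrightarrow> zs \<and>
              ((\<exists>a b. 0 < a \<and> b < 2 \<and> (\<forall>k. lam k \<in> {a..b})) \<longrightarrow> z \<longlonglongrightarrow> zs))))"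
    using T Pw0 zer bcz bczbar cz_lim czbar_lim part4
    unfolding w_def by (auto simp: seq_limit_point_def)
qed

end
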